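(* Let the setting and standing assumptions in the context hold, and run the projection-based Riemannian Bregman gradient method (described in the context) with initial point $x_0=\widetilde{x}$ and $\gamma_t=L$ for all $t\ge0$. Then every limit point $x$ of the generated sequence $\{x_t\}_{t\ge0}$ satisfies the optimality condition $\operatorname{grad} f(x)=0$ (with $x\in\mathcal M$). Moreover, for any given accuracy $\epsilon>0$, after at most $\mathcal O(\epsilon^{-2})$ iterations the method returns a direction with $\|v_t\|\le\epsilon$; that is, there is a constant $C>0$ independent of $\epsilon$ such that for every $\epsilon>0$ there is an index $t\le C\epsilon^{-2}$ with $\|v_t\|\le\epsilon$.
   Context: Setting. $\mathcal M\subseteq\mathbb R^n$ is a $C^\infty$ embedded submanifold, complete, endowed with the Euclidean inner product on each tangent space $\mathcal T_x\mathcal M\subseteq\mathbb R^n$; $\mathcal N_x\mathcal M$ is the orthogonal complement of $\mathcal T_x\mathcal M$ in $\mathbb R^n$. The problem is $\min_{x\in\mathcal M}F(x)$ with $F=f$ (there is no nonsmooth term), $f:\mathbb R^n\to\mathbb R$ continuously differentiable (possibly nonconvex), and $\inf_{\mathcal M}F>-\infty$. Assumptions. $h:\mathbb R^n\to\mathbb R$ is twice continuously differentiable and $\lambda$-strongly convex, $\lambda>0$; its Bregman distance is $D_h(y,x)=h(y)-h(x)-\langle\nabla h(x),y-x\rangle$. The function $f$ is $L$-smooth relative to $h$ ($L>0$): $f(y)\le f(x)+\langle\nabla f(x),y-x\rangle+L\,D_h(y,x)$ for all $x,y\in\mathbb R^n$. For some point $\widetilde{x}\in\mathcal M$, the sublevel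 set $\mathcal L(\widetilde{x})=\{x\in\mathcal M:F(x)\le F(\widetilde{x})\}$ is compact. Notation. $\operatorname{grad} f(x)$ is the orthogonal projection of $\nabla f(x)$ onto $\mathcal T_x\mathcal M$. $\mathcal P_{\mathcal M}(y)$ denotes the (Euclidean nearest-point) projection of $y$ onto $\mathcal M$; the projections evaluated by the algorithm are understood to exist. Algorithm (projection-based Riemannian Bregman gradient method). Input $x_0\in\mathcal M$, $\gamma_t\ge L$, $\tau\ge0$, $\rho\in(0,1)$. For $t=0,1,\dots$: compute $$v_t=\arg\min_{v\in\mathbb R^n}\ \langle\operatorname{grad} f(x_t),v\rangle+\gamma_tD_h(x_t+v,x_t);$$ choose any $u_t\in\mathcal N_{x_t}\mathcal M$ with $\|u_t\|\le\tau\|v_t\|$; set $\alpha_t=1$; while $F(\mathcal P_{\mathcal M}(x_t+\alpha_t(v_t+u_t)))-F(x_t)>-\frac{\gamma_t\lambda\alpha_t}{4}\|v_t\|^2$, replace $\alpha_t$ by $\rho\alpha_t$; then set $x_{t+1}=\mathcal P_{\mathcal M}(x_t+\alpha_t(v_t+u_t))$. *)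

theory Defs
  imports "HOL-Analysis.Analysis" "HOL-Library.While_Combinator"
begin

section \<open>Smoothness\<close>

text \<open>For open S in a Euclidean space: f is k times continuously differentiable on S, i.e. all
  iterated directional derivatives of order at most k exist and are continuous.\<close>

primrec C_k_on ::
  "nat \<Rightarrow> ('a::real_normed_vector \<Rightarrow> 'b::real_normed_vector) \<Rightarrow> 'a set \<Rightarrow> bool" where
  "C_k_on 0 f S \<longleftrightarrow> continuous_on S f"
| "C_k_on (Suc k) f S \<longleftrightarrow>
     (\<forall>x\<in>S. f differentiable (at x)) \<and>
     (\<forall>e. C_k_on k (\<lambda>x. frechet_derivative f (at x) e) S)"

definition smooth_on ::
  "('a::real_normed_vector \<Rightarrow> 'b::real_normed_vector) \<Rightarrow> 'a set \<Rightarrow> bool" where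
  "smooth_on f S \<longleftrightarrow> (\<forall>k. C_k_on k f S)"

definition nabla :: "('a::real_inner \<Rightarrow> real) \<Rightarrow> 'a \<Rightarrow> 'a" where
  "nabla f x = (THE g. GDERIV f x :> g)"

section \<open>Embedded submanifolds of Euclidean space\<close>

text \<open>Smooth slice charts: near each of its points, M is flattened by an ambient diffeomorphism
  onto an open piece of a d-dimensional linear subspace. M need not be closed.\<close>

definition embedded_submanifold :: "nat \<Rightarrow> 'a::euclidean_space set \<Rightarrow> bool" where
  "embedded_submanifold d M \<longleftrightarrow>
     (\<forall>x\<in>M. \<exists>(U :: 'a set) (V :: 'a set) \<phi> \<psi> (S :: 'a set).
        open U \<and> x \<in> U \<and> open V \<and> homeomorphism U V \<phi> \<psi> \<and>
        smooth_on \<phi> U \<and> smooth_on \<psi> V \<and>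
        subspace S \<and> dim S = d \<and> \<phi> ` (U \<inter> M) = V \<inter> S)"

text \<open>Velocities at x of smooth curves running in M.\<close>

definition tangent_space :: "'a::euclidean_space set \<Rightarrow> 'a \<Rightarrow> 'a set" where
  "tangent_space M x =
     {w. \<exists>(c::real \<Rightarrow> 'a) e. e > 0 \<and> smooth_on c {-e<..<e} \<and> c ` {-e<..<e} \<subseteq> M \<and>
           c 0 = x \<and> (c has_vector_derivative w) (at 0)}"

definition normal_space :: "'a::euclidean_space set \<Rightarrow> 'a \<Rightarrow> 'a set" where
  "normal_space M x = orthogonal_comp (tangent_space M x)"

definition orth_proj :: "'a::euclidean_space set \<Rightarrow> 'a \<Rightarrow> 'a" where
  "orth_proj S y = (THE p. p \<in> S \<and> y - p \<in> orthogonal_comp S)"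

definition riem_grad :: "'a::euclidean_space set \<Rightarrow> ('a \<Rightarrow> real) \<Rightarrow> 'a \<Rightarrow> 'a" where
  "riem_grad M f x = orth_proj (tangent_space M x) (nabla f x)"

text \<open>The Riemannian distance of the induced Euclidean metric: the infimum of lengths of piecewise
  C1 curves in M. It is infinite for points that no such curve joins. The length is a nonnegative
  Lebesgue integral, hence infinite (and not a default value 0) when the speed is not integrable;
  the finitely many break points are negligible.\<close>

definition curve_length :: "(real \<Rightarrow> 'a::euclidean_space) \<Rightarrow> ennreal" where
  "curve_length c = (\<integral>\<^sup>+ t \<in> {0..1}. ennreal (norm (vector_derivative c (at t))) \<partial>lebesgue)"

definition riem_dist :: "'a::euclidean_space set \<Rightarrow> 'a \<Rightarrow> 'a \<Rightarrow> ennreal" where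
  "riem_dist M x y =
     (INF c \<in> {c. valid_path c \<and> path_image c \<subseteq> M \<and> pathstart c = x \<and> pathfinish c = y}.
        curve_length c)"

text \<open>Completeness as a Riemannian manifold, which does not require M to be closed in the ambient
  space (every closed embedded submanifold is complete in this sense).\<close>

definition riem_complete :: "'a::euclidean_space set \<Rightarrow> bool" where
  "riem_complete M \<longleftrightarrow>
     (\<forall>X::nat \<Rightarrow> 'a. (\<forall>k. X k \<in> M) \<longrightarrow>
        (\<forall>e::real. e > 0 \<longrightarrow> (\<exists>N. \<forall>m\<ge>N. \<forall>k\<ge>N. riem_dist M (X m) (X k) < ennreal e)) \<longrightarrow>
        (\<exists>x\<in>M. (\<lambda>k. riem_dist M (X k) x) \<longlonglongrightarrow> 0))"

section \<open>Bregman distances and relative smoothness\<close>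

definition strongly_convex :: "real \<Rightarrow> ('a::real_inner \<Rightarrow> real) \<Rightarrow> bool" where
  "strongly_convex lam h \<longleftrightarrow>
     (\<forall>x y s. 0 \<le> s \<and> s \<le> 1 \<longrightarrow>
        h ((1 - s) *\<^sub>R x + s *\<^sub>R y)
          \<le> (1 - s) * h x + s * h y - lam / 2 * s * (1 - s) * (norm (x - y))\<^sup>2)"

definition bregman :: "('a::real_inner \<Rightarrow> real) \<Rightarrow> 'a \<Rightarrow> 'a \<Rightarrow> real" where
  "bregman h y x = h y - h x - nabla h x \<bullet> (y - x)"

definition rel_smooth :: "real \<Rightarrow> ('a::real_inner \<Rightarrow> real) \<Rightarrow> ('a \<Rightarrow> real) \<Rightarrow> bool" where
  "rel_smooth L h f \<longleftrightarrow>
     (\<forall>x y. f y \<le> f x + nabla f x \<bullet> (y - x) + L * bregman h y x)"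

section \<open>The projection-based Riemannian Bregman gradient method\<close>

definition is_nearest_point :: "'a::euclidean_space set \<Rightarrow> 'a \<Rightarrow> 'a \<Rightarrow> bool" where
  "is_nearest_point M y p \<longleftrightarrow> is_arg_min (dist y) (\<lambda>q. q \<in> M) p"

definition bregman_direction ::
  "'a::euclidean_space set \<Rightarrow> ('a \<Rightarrow> real) \<Rightarrow> ('a \<Rightarrow> real) \<Rightarrow> real \<Rightarrow> 'a \<Rightarrow> 'a" where
  "bregman_direction M f h \<gamma> x =
     arg_min (\<lambda>v. riem_grad M f x \<bullet> v + \<gamma> * bregman h (x + v) x) (\<lambda>_. True)"

definition rejected ::
  "('a::euclidean_space \<Rightarrow> real) \<Rightarrow> ('a \<Rightarrow> 'a) \<Rightarrow> real \<Rightarrow> real \<Rightarrow> 'a \<Rightarrow> 'a \<Rightarrow> 'a \<Rightarrow> real \<Rightarrow> bool" where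
  "rejected f P \<gamma> lam x v u a \<longleftrightarrow>
     f (P (x + a *\<^sub>R (v + u))) - f x > - (\<gamma> * lam * a / 4 * (norm v)\<^sup>2)"

text \<open>The map P chooses a nearest point. It is constrained only at the points where the algorithm
  evaluates it: the trial points with step size \<rho>^j all of whose predecessors were rejected.
  Termination of the line search is not assumed: the loop is the (total) while combinator, whose
  value is unspecified if the loop does not terminate. Likewise, existence of the minimizer
  defining the direction is not assumed.\<close>

definition rbg_run ::
  "'a::euclidean_space set \<Rightarrow> ('a \<Rightarrow> real) \<Rightarrow> ('a \<Rightarrow> real) \<Rightarrow> real \<Rightarrow> (nat \<Rightarrow> real) \<Rightarrow> real \<Rightarrow> real \<Rightarrow>
    ('a \<Rightarrow> 'a) \<Rightarrow> 'a \<Rightarrow> (nat \<Rightarrow> 'a) \<Rightarrow> (nat \<Rightarrow> 'a) \<Rightarrow> (nat \<Rightarrow> 'a) \<Rightarrow> (nat \<Rightarrow> real) \<Rightarrow> bool" where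
  "rbg_run M f h lam \<gamma> \<tau> \<rho> P x\<^sub>0 x v u \<alpha> \<longleftrightarrow>
     x 0 = x\<^sub>0 \<and>
     (\<forall>t. v t = bregman_direction M f h (\<gamma> t) (x t) \<and>
          u t \<in> normal_space M (x t) \<and> norm (u t) \<le> \<tau> * norm (v t) \<and>
          (\<forall>j::nat. (\<forall>i<j. rejected f P (\<gamma> t) lam (x t) (v t) (u t) (\<rho> ^ i)) \<longrightarrow>
             (let y = x t + (\<rho> ^ j) *\<^sub>R (v t + u t) in is_nearest_point M y (P y))) \<and>
          \<alpha> t = while (rejected f P (\<gamma> t) lam (x t) (v t) (u t)) (\<lambda>a. \<rho> * a) 1 \<and>
          x (Suc t) = P (x t + \<alpha> t *\<^sub>R (v t + u t)))"

end

theory Submission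
  imports Defs
begin

text \<open>In slice charts one sees that, uniformly for x in a compact part of M and p in M, the chord p - x
  is tangent at x up to O(|p - x|^2), and the tangent space at p deviates from that at x by
  O(|p - x|). If p is the point of M nearest to x + w, then x + w - p is normal at p, hence almost
  normal at x, so \<open>\<nabla>f x \<bullet> (p - x) \<le> grad f x \<bullet> w + O(|w|\<^sup>2)\<close>. For \<open>w = \<alpha> (v + u)\<close> with u normal the
  linear term is \<open>\<alpha> (grad f x \<bullet> v) \<le> - \<alpha> L \<lambda> |v|\<^sup>2\<close>, while relative smoothness and all remainders
  cost \<open>O(\<alpha>\<^sup>2 |v|\<^sup>2)\<close>. Hence steps below a uniform threshold are accepted, each iteration decreases f
  by at least a constant times \<open>|v|\<^sup>2\<close>, and telescoping gives the rate. Since v tends to 0, so does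
  \<open>grad f (x_t) = L (\<nabla>h (x_t) - \<nabla>h (x_t + v_t))\<close>.\<close>

section \<open>Derivatives of functions of class C1 and C2\<close>

text \<open>\<open>frechet_derivative\<close> sees a function on a whole neighbourhood, so openness
  of \<open>S\<close> is what lets agreement on \<open>S\<close> pass to derivatives. Both functions
  are generalised in the induction, because the step applies it to their directional
  derivatives.\<close>

lemma C_k_on_cong:
  assumes "open S" "\<And>x. x \<in> S \<Longrightarrow> f x = g x" "C_k_on k f S"
  shows "C_k_on k g S"
  using assms(2,3)
proof (induction k arbitrary: f g)
  case 0
  then show ?case by (simp cong: continuous_on_cong)
next
  case (Suc k)
  have der: "(g has_derivative frechet_derivative f (at x)) (at x)" if "x \<in> S" for x
  proof (rule has_derivative_transform_within_open[OF _ \<open>open S\<close> that Suc.prems(1)])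
    show "(f has_derivative frechet_derivative f (at x)) (at x)"
      using Suc.prems(2) that frechet_derivative_works by auto
  qed
  show ?case
  proof (simp, intro conjI ballI allI)
    fix x assume "x \<in> S"
    then show "g differentiable at x" using der differentiable_def by blast
  next
    fix e
    show "C_k_on k (\<lambda>x. frechet_derivative g (at x) e) S"
    proof (rule Suc.IH)
      show "frechet_derivative f (at x) e = frechet_derivative g (at x) e" if "x \<in> S" for x
        using frechet_derivative_at[OF der[OF that]] by simp
    qed (use Suc.prems in auto)
  qed
qed

text \<open>Supplies the smooth curves that witness tangent vectors. Along a fixed line the chain
  rule gives a directional derivative of \<open>g\<close> in the constant direction
  \<open>e *\<^sub>R s\<close>, composed with the same line, so the induction closes without a chain
  rule for general compositions.\<close>

lemma C_k_on_compose_line: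
  fixes g :: "'a::real_normed_vector \<Rightarrow> 'b::real_normed_vector" and a s :: 'a
  assumes "open I" "\<And>t. t \<in> I \<Longrightarrow> a + t *\<^sub>R s \<in> V" "C_k_on k g V"
  shows "C_k_on k (\<lambda>t::real. g (a + t *\<^sub>R s)) I"
  using assms(3)
proof (induction k arbitrary: g)
  case 0
  then show ?case
    using assms(2) by (auto intro!: continuous_intros intro: continuous_on_compose2)
next
  case (Suc k)
  have der: "((\<lambda>t. g (a + t *\<^sub>R s)) has_derivative
      (\<lambda>e. frechet_derivative g (at (a + t *\<^sub>R s)) (e *\<^sub>R s))) (at t)" if "t \<in> I" for t
  proof -
    have "(g has_derivative frechet_derivative g (at (a + t *\<^sub>R s))) (at (a + t *\<^sub>R s))"
      using Suc.prems assms(2)[OF that] frechet_derivative_works by auto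
    moreover have "((\<lambda>t. a + t *\<^sub>R s) has_derivative (\<lambda>e. e *\<^sub>R s)) (at t)"
      by (auto intro!: derivative_eq_intros)
    ultimately show ?thesis
      using has_derivative_compose by blast
  qed
  show ?case
  proof (simp, intro conjI ballI allI)
    fix t assume "t \<in> I"
    then show "(\<lambda>t. g (a + t *\<^sub>R s)) differentiable at t" using der differentiable_def by blast
  next
    fix e
    have "C_k_on k (\<lambda>t. frechet_derivative g (at (a + t *\<^sub>R s)) (e *\<^sub>R s)) I"
      by (rule Suc.IH[of "\<lambda>y. frechet_derivative g (at y) (e *\<^sub>R s)"]) (use Suc.prems in auto)
    then show "C_k_on k (\<lambda>t. frechet_derivative (\<lambda>t. g (a + t *\<^sub>R s)) (at t) e) I"
    proof (rule C_k_on_cong[OF \<open>open I\<close>, rotated])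
      show "frechet_derivative g (at (a + t *\<^sub>R s)) (e *\<^sub>R s)
          = frechet_derivative (\<lambda>t. g (a + t *\<^sub>R s)) (at t) e" if "t \<in> I" for t
        using frechet_derivative_at[OF der[OF that]] by metis
    qed
  qed
qed

text \<open>\<open>C_k_on\<close> gives continuity of the derivative only for one fixed direction at
  a time. Bounds for the basis directions on the compact set add up, by linearity, to one bound for
  all directions.\<close>

lemma C_1_on_derivative_bounded:
  fixes g :: "'a::euclidean_space \<Rightarrow> 'b::real_normed_vector"
  assumes "C_k_on 1 g S" "B \<subseteq> S" "compact B"
  obtains C where "C \<ge> 0" "\<And>x w. x \<in> B \<Longrightarrow> norm (frechet_derivative g (at x) w) \<le> C * norm w"
proof -
  have "\<exists>c. \<forall>x\<in>B. norm (frechet_derivative g (at x) i) \<le> c" for i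
  proof -
    have "continuous_on B (\<lambda>x. frechet_derivative g (at x) i)"
      using assms(1,2) by (auto intro: continuous_on_subset)
    then have "bounded ((\<lambda>x. frechet_derivative g (at x) i) ` B)"
      using assms(3) compact_continuous_image compact_imp_bounded by blast
    then show ?thesis by (auto simp: bounded_iff)
  qed
  then obtain c where c: "\<And>x i. x \<in> B \<Longrightarrow> norm (frechet_derivative g (at x) i) \<le> c i"
    by metis
  show thesis
  proof
    show "0 \<le> (\<Sum>i\<in>Basis. \<bar>c i\<bar>)" by (simp add: sum_nonneg)
    fix x w assume x: "x \<in> B"
    then have lin: "linear (frechet_derivative g (at x))"
      using assms by (auto intro: linear_frechet_derivative)
    have "frechet_derivative g (at x) w
        = frechet_derivative g (at x) (\<Sum>i\<in>Basis. (w \<bullet> i) *\<^sub>R i)"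
      by (simp add: euclidean_representation)
    also have "\<dots> = (\<Sum>i\<in>Basis. (w \<bullet> i) *\<^sub>R frechet_derivative g (at x) i)"
      by (simp add: linear_sum[OF lin] linear_scale[OF lin])
    also have "norm \<dots> \<le> (\<Sum>i\<in>Basis. \<bar>c i\<bar> * norm w)"
    proof (rule sum_norm_le)
      fix i :: 'a assume "i \<in> Basis"
      then have "\<bar>w \<bullet> i\<bar> * norm (frechet_derivative g (at x) i) \<le> norm w * \<bar>c i\<bar>"
        using c[OF x, of i] by (intro mult_mono) (auto simp: Basis_le_norm)
      then show "norm ((w \<bullet> i) *\<^sub>R frechet_derivative g (at x) i) \<le> \<bar>c i\<bar> * norm w"
        by (simp add: mult.commute)
    qed
    finally show "norm (frechet_derivative g (at x) w) \<le> (\<Sum>i\<in>Basis. \<bar>c i\<bar>) * norm w"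
      by (simp add: sum_distrib_right)
  qed
qed

lemma C_1_on_Lipschitz:
  fixes g :: "'a::euclidean_space \<Rightarrow> 'b::real_normed_vector"
  assumes "C_k_on 1 g S" "B \<subseteq> S" "compact B" "convex B"
  obtains C where "C \<ge> 0" "\<And>x y. x \<in> B \<Longrightarrow> y \<in> B \<Longrightarrow> norm (g x - g y) \<le> C * norm (x - y)"
proof -
  obtain C where C: "C \<ge> 0"
    "\<And>x w. x \<in> B \<Longrightarrow> norm (frechet_derivative g (at x) w) \<le> C * norm w"
    using C_1_on_derivative_bounded[OF assms(1-3)] by blast
  have "(g has_derivative frechet_derivative g (at x)) (at x within B)" if "x \<in> B" for x
    using assms(1,2) that frechet_derivative_works has_derivative_at_withinI by fastforce
  then have "norm (g x - g y) \<le> C * norm (x - y)" if "x \<in> B" "y \<in> B" for x y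
    by (rule differentiable_bound[OF assms(4) _ onorm_le that]) (use C(2) in auto)
  then show thesis using C(1) that by blast
qed

text \<open>Each directional derivative along a basis vector is of class C1, hence Lipschitz on
  \<open>B\<close>, and linearity extends this to all directions. The Taylor estimate then follows
  from the mean value inequality for \<open>g\<close> minus its linearization at \<open>x\<close>;
  the sharp factor 1/2 is given up so that one constant serves both.\<close>

lemma C_2_on_derivative_Lipschitz:
  fixes g :: "'a::euclidean_space \<Rightarrow> 'b::real_normed_vector"
  assumes "C_k_on 2 g S" "B \<subseteq> S" "compact B" "convex B"
  obtains C where "C \<ge> 0"
    "\<And>x y w. x \<in> B \<Longrightarrow> y \<in> B \<Longrightarrow>
      norm (frechet_derivative g (at x) w - frechet_derivative g (at y) w) \<le> C * norm (x - y) * norm w"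
    "\<And>x y. x \<in> B \<Longrightarrow> y \<in> B \<Longrightarrow>
      norm (g y - g x - frechet_derivative g (at x) (y - x)) \<le> C * (norm (y - x))\<^sup>2"
proof -
  have C1: "C_k_on 1 (\<lambda>x. frechet_derivative g (at x) i) S" for i
    using assms(1) by (simp add: numeral_2_eq_2)
  have dg: "(g has_derivative frechet_derivative g (at x)) (at x)" if "x \<in> B" for x
    using assms(1,2) that by (auto simp: numeral_2_eq_2 frechet_derivative_works[symmetric])
  have "\<exists>c. \<forall>x\<in>B. \<forall>y\<in>B. norm (frechet_derivative g (at x) i - frechet_derivative g (at y) i)
      \<le> c * norm (x - y)" for i
    using C_1_on_Lipschitz[OF C1 assms(2-4)] by metis
  then obtain c where c: "\<And>x y i. x \<in> B \<Longrightarrow> y \<in> B \<Longrightarrow>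
      norm (frechet_derivative g (at x) i - frechet_derivative g (at y) i) \<le> c i * norm (x - y)"
    by metis
  define C where "C = (\<Sum>i\<in>Basis. \<bar>c i\<bar>)"
  have C0: "C \<ge> 0" unfolding C_def by (simp add: sum_nonneg)
  have lip: "norm (frechet_derivative g (at x) w - frechet_derivative g (at y) w)
      \<le> C * norm (x - y) * norm w" if x: "x \<in> B" and y: "y \<in> B" for x y w
  proof -
    have lin: "linear (\<lambda>w. frechet_derivative g (at x) w - frechet_derivative g (at y) w)"
      using dg[OF x] dg[OF y]
      by (intro bounded_linear.linear bounded_linear_sub has_derivative_bounded_linear)
    have "frechet_derivative g (at x) w - frechet_derivative g (at y) w
        = (\<lambda>w. frechet_derivative g (at x) w - frechet_derivative g (at y) w)
            (\<Sum>i\<in>Basis. (w \<bullet> i) *\<^sub>R i)"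
      by (simp add: euclidean_representation)
    also have "\<dots> = (\<Sum>i\<in>Basis. (w \<bullet> i) *\<^sub>R
        (frechet_derivative g (at x) i - frechet_derivative g (at y) i))"
      by (simp only: linear_sum[OF lin] linear_scale[OF lin])
    also have "norm \<dots> \<le> (\<Sum>i\<in>Basis. \<bar>c i\<bar> * (norm (x - y) * norm w))"
    proof (rule sum_norm_le)
      fix i :: 'a assume "i \<in> Basis"
      moreover have "norm (frechet_derivative g (at x) i - frechet_derivative g (at y) i)
          \<le> \<bar>c i\<bar> * norm (x - y)"
        using c[OF x y, of i] by (meson abs_ge_self mult_right_mono norm_ge_zero order_trans)
      ultimately have "\<bar>w \<bullet> i\<bar> * norm (frechet_derivative g (at x) i - frechet_derivative g (at y) i)
          \<le> norm w * (\<bar>c i\<bar> * norm (x - y))"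
        by (intro mult_mono) (auto simp: Basis_le_norm)
      then show "norm ((w \<bullet> i) *\<^sub>R (frechet_derivative g (at x) i - frechet_derivative g (at y) i))
          \<le> \<bar>c i\<bar> * (norm (x - y) * norm w)"
        by (simp add: mult_ac)
    qed
    finally show ?thesis by (simp add: C_def sum_distrib_right mult.assoc)
  qed
  have taylor: "norm (g y - g x - frechet_derivative g (at x) (y - x)) \<le> C * (norm (y - x))\<^sup>2"
    if x: "x \<in> B" and y: "y \<in> B" for x y
  proof -
    have sub: "closed_segment x y \<subseteq> B"
      using assms(4) x y by (rule closed_segment_subset[rotated 2])
    have "norm (g y - g x - frechet_derivative g (at x) (y - x)) \<le> norm (y - x) * (C * norm (y - x))"
    proof (rule differentiable_bound_linearization[where S = "closed_segment x y"])
      show "x + t *\<^sub>R (y - x) \<in> closed_segment x y" if "t \<in> {0..1}" for t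
        using that by (auto simp: in_segment algebra_simps intro!: exI[of _ t])
      show "(g has_derivative frechet_derivative g (at z)) (at z within closed_segment x y)"
        if "z \<in> closed_segment x y" for z
        using dg sub that by (blast intro: has_derivative_at_withinI)
      show "onorm (frechet_derivative g (at z) - frechet_derivative g (at x)) \<le> C * norm (y - x)"
        if z: "z \<in> closed_segment x y" for z
      proof (rule onorm_le, simp)
        fix w
        have "norm (frechet_derivative g (at z) w - frechet_derivative g (at x) w)
            \<le> C * norm (z - x) * norm w"
          using sub z x by (blast intro: lip)
        also have "\<dots> \<le> C * norm (y - x) * norm w"
          using segment_bound(1)[OF z] C0 by (intro mult_right_mono mult_left_mono) auto
        finally show "norm (frechet_derivative g (at z) w - frechet_derivative g (at x) w)
            \<le> C * norm (y - x) * norm w" .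
      qed
    qed simp
    then show ?thesis by (simp add: power2_eq_square mult_ac)
  qed
  show thesis using that[OF C0 lip taylor] .
qed

lemma has_vector_derivative_quotient:
  fixes g :: "real \<Rightarrow> 'a::real_normed_vector"
  assumes "(g has_vector_derivative w) (at 0)"
  shows "((\<lambda>t. (g t - g 0) /\<^sub>R t) \<longlongrightarrow> w) (at 0)"
proof -
  have "((\<lambda>t. norm ((g t - g 0) - t *\<^sub>R w) / norm t) \<longlongrightarrow> 0) (at 0)"
    using assms unfolding has_vector_derivative_def has_derivative_iff_norm by simp
  moreover have "\<forall>\<^sub>F t in at 0. norm ((g t - g 0) - t *\<^sub>R w) / norm t = norm ((g t - g 0) /\<^sub>R t - w)"
  \<comment> \<open>The radius 1 is arbitrary: only t \<noteq> 0 matters, for dividing by t.\<close>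
  proof (rule eventually_at_ball'[THEN eventually_mono, of 1])
    fix t :: real assume "t \<in> ball 0 1 \<and> t \<noteq> 0 \<and> t \<in> UNIV"
    then have "(g t - g 0) /\<^sub>R t - w = ((g t - g 0) - t *\<^sub>R w) /\<^sub>R t"
      by (simp add: scaleR_diff_right)
    then show "norm ((g t - g 0) - t *\<^sub>R w) / norm t = norm ((g t - g 0) /\<^sub>R t - w)"
      by (simp only: norm_scaleR real_norm_def abs_inverse divide_inverse mult.commute)
  qed simp
  ultimately have "((\<lambda>t. norm ((g t - g 0) /\<^sub>R t - w)) \<longlongrightarrow> 0) (at 0)"
    by (rule Lim_transform_eventually)
  then show ?thesis by (rule LIM_zero_cancel[OF tendsto_norm_zero_cancel])
qed

section \<open>Second-order geometry of embedded submanifolds\<close>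

locale slice_chart =
  fixes M U V S :: "'a::euclidean_space set" and \<phi> \<psi> :: "'a \<Rightarrow> 'a"
  assumes openU: "open U" and openV: "open V" and homeo: "homeomorphism U V \<phi> \<psi>"
    and smooth_phi: "smooth_on \<phi> U" and smooth_psi: "smooth_on \<psi> V"
    and subS: "subspace S" and slice: "\<phi> ` (U \<inter> M) = V \<inter> S"
begin

lemma phi_deriv: "y \<in> U \<Longrightarrow> (\<phi> has_derivative frechet_derivative \<phi> (at y)) (at y)"
  using smooth_phi unfolding smooth_on_def
  by (metis C_k_on.simps(2) frechet_derivative_works)

lemma psi_deriv: "b \<in> V \<Longrightarrow> (\<psi> has_derivative frechet_derivative \<psi> (at b)) (at b)"
  using smooth_psi unfolding smooth_on_def
  by (metis C_k_on.simps(2) frechet_derivative_works)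

lemma psi_phi: "y \<in> U \<Longrightarrow> \<psi> (\<phi> y) = y" and phi_U: "y \<in> U \<Longrightarrow> \<phi> y \<in> V"
  and psi_V: "b \<in> V \<Longrightarrow> \<psi> b \<in> U" and phi_psi: "b \<in> V \<Longrightarrow> \<phi> (\<psi> b) = b"
  using homeo by (auto simp: homeomorphism_def)

lemma psi_slice: "b \<in> V \<Longrightarrow> b \<in> S \<Longrightarrow> \<psi> b \<in> M"
proof -
  assume "b \<in> V" "b \<in> S"
  then have "b \<in> \<phi> ` (U \<inter> M)" using slice by auto
  then show "\<psi> b \<in> M" using psi_phi by auto
qed

lemma phi_slice: "y \<in> U \<Longrightarrow> y \<in> M \<Longrightarrow> \<phi> y \<in> S"
  using slice by blast

text \<open>Differentiate the identity \<open>\<psi> (\<phi> y) = y\<close>, valid on the open set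
  \<open>U\<close>.\<close>

lemma dpsi_dphi:
  assumes "y \<in> U"
  shows "frechet_derivative \<psi> (at (\<phi> y)) (frechet_derivative \<phi> (at y) w) = w"
proof -
  have "((\<lambda>y. \<psi> (\<phi> y)) has_derivative
      (\<lambda>w. frechet_derivative \<psi> (at (\<phi> y)) (frechet_derivative \<phi> (at y) w))) (at y)"
    by (rule has_derivative_compose[OF phi_deriv psi_deriv]) (use assms phi_U in auto)
  moreover have "((\<lambda>y. \<psi> (\<phi> y)) has_derivative (\<lambda>w. w)) (at y)"
    by (rule has_derivative_transform_within_open[OF has_derivative_ident openU assms])
      (simp add: psi_phi)
  ultimately show ?thesis
    using has_derivative_unique by metis
qed

text \<open>The chart carries a curve in \<open>M\<close> into the subspace \<open>S\<close> near
  time 0. Its difference quotients lie in \<open>S\<close>, and \<open>S\<close> is closed, so the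
  velocity lies in \<open>S\<close> as well.\<close>

lemma dphi_tangent:
  assumes y: "y \<in> U" and w: "w \<in> tangent_space M y"
  shows "frechet_derivative \<phi> (at y) w \<in> S"
proof -
  obtain c e where c: "e > 0" "c ` {-e<..<e} \<subseteq> M" "c (0::real) = y"
    "(c has_vector_derivative w) (at 0)"
    using w unfolding tangent_space_def by blast
  have der: "((\<lambda>t. \<phi> (c t)) has_derivative (\<lambda>t. frechet_derivative \<phi> (at y) (t *\<^sub>R w))) (at 0)"
    using has_derivative_compose[OF c(4)[unfolded has_vector_derivative_def]] phi_deriv[OF y] c(3)
    by auto
  have lin: "linear (frechet_derivative \<phi> (at y))"
    using phi_deriv[OF y] has_derivative_linear by blast
  have "((\<lambda>t. \<phi> (c t)) has_vector_derivative frechet_derivative \<phi> (at y) w) (at 0)"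
    using der by (simp add: has_vector_derivative_def linear_scale[OF lin])
  then have lim: "((\<lambda>t. (\<phi> (c t) - \<phi> y) /\<^sub>R t) \<longlongrightarrow> frechet_derivative \<phi> (at y) w) (at 0)"
    by (rule has_vector_derivative_quotient[where g = "\<lambda>t. \<phi> (c t)", unfolded c(3)])
  have "\<forall>\<^sub>F t in at 0. c t \<in> U"
  proof -
    have "isCont c 0" using c(4) has_vector_derivative_continuous by blast
    then show ?thesis using openU y c(3) unfolding isCont_def by (auto intro: topological_tendstoD)
  qed
  moreover have "\<forall>\<^sub>F t in at 0. c t \<in> M"
    using c(1,2) by (auto simp: eventually_at image_subset_iff abs_less_iff intro!: exI[of _ e])
  ultimately have "\<forall>\<^sub>F t in at 0. (\<phi> (c t) - \<phi> y) /\<^sub>R t \<in> S"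
  proof eventually_elim
    case (elim t)
    have "y \<in> M" using c(1-3) by force
    then show ?case
      using elim y phi_slice subS by (auto intro!: subspace_scale subspace_diff)
  qed
  then show ?thesis
    using Lim_in_closed_set[OF closed_subspace[OF subS] _ _ lim] by auto
qed

text \<open>The witnessing curve is the image under \<open>\<psi>\<close> of the straight line
  through \<open>\<phi> y\<close> with direction \<open>s\<close>; it stays in
  \<open>V \<inter> S\<close>, hence its image in \<open>M\<close>, for short times.\<close>

lemma dpsi_tangent:
  assumes y: "y \<in> U" "y \<in> M" and s: "s \<in> S"
  shows "frechet_derivative \<psi> (at (\<phi> y)) s \<in> tangent_space M y"
proof -
  have "\<phi> y \<in> V" "\<phi> y \<in> S" using y phi_U phi_slice by auto
  then have "\<exists>e>0. \<forall>t. \<bar>t\<bar> < e \<longrightarrow> \<phi> y + t *\<^sub>R s \<in> V \<inter> S"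
  proof -
    have "open ((\<lambda>t::real. \<phi> y + t *\<^sub>R s) -` V)"
      using openV by (intro open_vimage continuous_intros)
    then obtain e where "e > 0" "ball 0 e \<subseteq> (\<lambda>t::real. \<phi> y + t *\<^sub>R s) -` V"
      using \<open>\<phi> y \<in> V\<close> unfolding open_contains_ball by force
    then show ?thesis
      using \<open>\<phi> y \<in> S\<close> s subS
      by (intro exI[of _ e]) (auto simp: dist_norm subset_iff intro!: subspace_add subspace_scale)
  qed
  then obtain e where e: "e > 0" "\<And>t. \<bar>t\<bar> < e \<Longrightarrow> \<phi> y + t *\<^sub>R s \<in> V" "\<And>t. \<bar>t\<bar> < e \<Longrightarrow> \<phi> y + t *\<^sub>R s \<in> S"
    by blast
  define c where "c = (\<lambda>t::real. \<psi> (\<phi> y + t *\<^sub>R s))"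
  have "smooth_on c {-e<..<e}"
    unfolding smooth_on_def c_def
    using e(2) smooth_psi by (auto intro!: C_k_on_compose_line[where V = V] simp: smooth_on_def abs_less_iff)
  moreover have "c ` {-e<..<e} \<subseteq> M"
    using e(2,3) psi_slice by (auto simp: c_def abs_less_iff)
  moreover have "c 0 = y" using psi_phi[OF y(1)] by (simp add: c_def)
  moreover have "(c has_vector_derivative frechet_derivative \<psi> (at (\<phi> y)) s) (at 0)"
  proof -
    have d: "(\<psi> has_derivative frechet_derivative \<psi> (at (\<phi> y))) (at (\<phi> y + 0 *\<^sub>R s))"
      using psi_deriv[OF \<open>\<phi> y \<in> V\<close>] by simp
    have "((\<lambda>t::real. \<phi> y + t *\<^sub>R s) has_derivative (\<lambda>t. t *\<^sub>R s)) (at 0)"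
      by (auto intro!: derivative_eq_intros)
    from has_derivative_compose[OF this d] show ?thesis
      using linear_scale[OF has_derivative_linear[OF d]] by (simp add: has_vector_derivative_def c_def)
  qed
  ultimately show ?thesis
    using e(1) unfolding tangent_space_def by blast
qed

text \<open>Velocities of curves do not visibly form a vector space; as a linear image of
  \<open>S\<close> they do.\<close>

lemma tangent_space_eq:
  assumes "y \<in> U" "y \<in> M"
  shows "tangent_space M y = frechet_derivative \<psi> (at (\<phi> y)) ` S"
proof
  show "tangent_space M y \<subseteq> frechet_derivative \<psi> (at (\<phi> y)) ` S"
    using dphi_tangent[OF assms(1)] dpsi_dphi[OF assms(1)] by (metis image_eqI subsetI)
qed (use dpsi_tangent[OF assms] in blast)

text \<open>Both estimates are read off in the flat picture, where chords of the slice are tangent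
  and all tangent spaces coincide with \<open>S\<close>. Lipschitz continuity of
  \<open>\<phi>\<close> and a Taylor bound for \<open>\<psi>\<close> bring them back to
  \<open>M\<close>.\<close>

lemma local_second_order:
  assumes z: "z \<in> U"
  obtains r C where "r > 0" "C \<ge> 0"
    "\<And>x p. x \<in> M \<inter> ball z r \<Longrightarrow> p \<in> M \<inter> ball z r \<Longrightarrow>
      \<exists>q\<in>tangent_space M x. norm (p - x - q) \<le> C * (norm (p - x))\<^sup>2"
    "\<And>x p w. x \<in> M \<inter> ball z r \<Longrightarrow> p \<in> M \<inter> ball z r \<Longrightarrow> w \<in> tangent_space M x \<Longrightarrow>
      \<exists>w'\<in>tangent_space M p. norm (w - w') \<le> C * norm (p - x) * norm w"
proof -
  \<comment> \<open>The bounds for \<open>\<psi>\<close> need a compact convex set in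
    \<open>V\<close>; the radius \<open>r\<close> is then chosen so that \<open>\<phi>\<close> maps
    the ball around \<open>z\<close> into it.\<close>
  obtain r2 where r2: "r2 > 0" "cball (\<phi> z) r2 \<subseteq> V"
    using openV phi_U[OF z] open_contains_cball by blast
  have "continuous_on U \<phi>" using homeo by (simp add: homeomorphism_def)
  then have "open (U \<inter> \<phi> -` ball (\<phi> z) r2)"
    using openU by (auto intro: continuous_open_preimage)
  then obtain r where r: "r > 0" "cball z r \<subseteq> U \<inter> \<phi> -` ball (\<phi> z) r2"
    using z r2(1) unfolding open_contains_cball by (metis IntI centre_in_ball vimageI2)
  have rU: "cball z r \<subseteq> U" using r(2) by blast
  have phi1: "C_k_on 1 \<phi> U" and psi2: "C_k_on 2 \<psi> V"
    using smooth_phi smooth_psi unfolding smooth_on_def by blast+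
  obtain C1 where C1: "C1 \<ge> 0"
    "\<And>x y. x \<in> cball z r \<Longrightarrow> y \<in> cball z r \<Longrightarrow> norm (\<phi> x - \<phi> y) \<le> C1 * norm (x - y)"
    using C_1_on_Lipschitz[OF phi1 rU compact_cball convex_cball] by blast
  obtain C2 where C2: "C2 \<ge> 0"
    "\<And>x w. x \<in> cball z r \<Longrightarrow> norm (frechet_derivative \<phi> (at x) w) \<le> C2 * norm w"
    using C_1_on_derivative_bounded[OF phi1 rU compact_cball] by blast
  obtain C3 where C3: "C3 \<ge> 0"
    "\<And>a b w. a \<in> cball (\<phi> z) r2 \<Longrightarrow> b \<in> cball (\<phi> z) r2 \<Longrightarrow>
      norm (frechet_derivative \<psi> (at a) w - frechet_derivative \<psi> (at b) w) \<le> C3 * norm (a - b) * norm w"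
    "\<And>a b. a \<in> cball (\<phi> z) r2 \<Longrightarrow> b \<in> cball (\<phi> z) r2 \<Longrightarrow>
      norm (\<psi> b - \<psi> a - frechet_derivative \<psi> (at a) (b - a)) \<le> C3 * (norm (b - a))\<^sup>2"
    using C_2_on_derivative_Lipschitz[OF psi2 r2(2) compact_cball convex_cball] by metis
  \<comment> \<open>The first summand serves the chord estimate, the second the comparison of
    tangent spaces.\<close>
  define C where "C = C3 * C1\<^sup>2 + C3 * C1 * C2"
  have in2: "\<phi> y \<in> cball (\<phi> z) r2" and inU: "y \<in> U" and in1: "y \<in> cball z r" if "y \<in> M \<inter> ball z r" for y
    using r(2) that by (auto simp: subset_iff less_imp_le)
  show thesis
  proof (rule that[of r C])
    show "r > 0" by fact
    show "C \<ge> 0" unfolding C_def using C1 C2 C3 by auto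
  next
    fix x p assume x: "x \<in> M \<inter> ball z r" and p: "p \<in> M \<inter> ball z r"
    \<comment> \<open>The linear part of \<open>\<psi>\<close> along the chord in the slice; it is
      tangent because \<open>S\<close> contains that chord.\<close>
    let ?q = "frechet_derivative \<psi> (at (\<phi> x)) (\<phi> p - \<phi> x)"
    have "?q \<in> tangent_space M x"
      using x p inU phi_slice subS by (auto intro!: dpsi_tangent subspace_diff)
    moreover have "norm (p - x - ?q) \<le> C * (norm (p - x))\<^sup>2"
    proof -
      have "norm (p - x - ?q) \<le> C3 * (norm (\<phi> p - \<phi> x))\<^sup>2"
        using C3(3)[OF in2[OF x] in2[OF p]] psi_phi[OF inU[OF x]] psi_phi[OF inU[OF p]] by simp
      also have "\<dots> \<le> C3 * (C1 * norm (p - x))\<^sup>2"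
        using C3(1) C1(2)[OF in1[OF p] in1[OF x]] by (intro mult_left_mono power_mono) auto
      also have "\<dots> \<le> C * (norm (p - x))\<^sup>2"
        using C1(1) C2(1) C3(1) by (simp add: C_def power_mult_distrib distrib_right)
      finally show ?thesis .
    qed
    ultimately show "\<exists>q\<in>tangent_space M x. norm (p - x - q) \<le> C * (norm (p - x))\<^sup>2" by blast
  next
    fix x p w assume x: "x \<in> M \<inter> ball z r" and p: "p \<in> M \<inter> ball z r" and w: "w \<in> tangent_space M x"
    \<comment> \<open>Transport of \<open>w\<close> from \<open>x\<close> to \<open>p\<close>: keep
      its slice coordinates \<open>s\<close> and push them forward at \<open>p\<close> instead of at
      \<open>x\<close>.\<close>
    define s where "s = frechet_derivative \<phi> (at x) w"
    have s: "s \<in> S" "frechet_derivative \<psi> (at (\<phi> x)) s = w"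
      using dphi_tangent[OF inU[OF x] w] dpsi_dphi[OF inU[OF x]] by (auto simp: s_def)
    let ?w = "frechet_derivative \<psi> (at (\<phi> p)) s"
    have "?w \<in> tangent_space M p"
      using dpsi_tangent[OF inU[OF p] _ s(1)] p by auto
    moreover have "norm (w - ?w) \<le> C * norm (p - x) * norm w"
    proof -
      have "norm (w - ?w) \<le> C3 * norm (\<phi> x - \<phi> p) * norm s"
        using C3(2)[OF in2[OF x] in2[OF p], of s] s(2) by simp
      also have "\<dots> \<le> C3 * (C1 * norm (x - p)) * (C2 * norm w)"
        using C1 C2(1) C2(2)[OF in1[OF x], of w] C3(1) C1(2)[OF in1[OF x] in1[OF p]] unfolding s_def
        by (intro mult_mono mult_left_mono) auto
      also have "\<dots> = C3 * C1 * C2 * norm (p - x) * norm w"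
        by (simp add: norm_minus_commute)
      also have "\<dots> \<le> C * norm (p - x) * norm w"
        using C3(1) by (intro mult_right_mono) (auto simp: C_def)
      finally show ?thesis .
    qed
    ultimately show "\<exists>w'\<in>tangent_space M p. norm (w - w') \<le> C * norm (p - x) * norm w" by blast
  qed
qed

end

section \<open>Estimates uniform over a compact part of the manifold\<close>

lemma embedded_submanifold_chart:
  fixes M :: "'a::euclidean_space set"
  assumes "embedded_submanifold d M" "x \<in> M"
  obtains U V S :: "'a set" and \<phi> \<psi> where "slice_chart M U V S \<phi> \<psi>" "x \<in> U"
proof -
  obtain U V S :: "'a set" and \<phi> \<psi> where "open U \<and> x \<in> U \<and> open V \<and> homeomorphism U V \<phi> \<psi> \<and>
        smooth_on \<phi> U \<and> smooth_on \<psi> V \<and>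
        subspace S \<and> dim S = d \<and> \<phi> ` (U \<inter> M) = V \<inter> S"
    using assms unfolding embedded_submanifold_def by metis
  then show thesis using that[of U V S \<phi> \<psi>] by (simp add: slice_chart_def)
qed

lemma subspace_tangent_space:
  assumes "embedded_submanifold d M" "x \<in> M"
  shows "subspace (tangent_space M x)"
proof -
  obtain U V S \<phi> \<psi> where "slice_chart M U V S \<phi> \<psi>" and x: "x \<in> U"
    using embedded_submanifold_chart[OF assms] by blast
  then interpret slice_chart M U V S \<phi> \<psi> by simp
  show ?thesis
    using psi_deriv[OF phi_U[OF x]] subS unfolding tangent_space_eq[OF x assms(2)]
    by (intro linear_subspace_image) (auto dest: has_derivative_linear)
qed

text \<open>The charts treat only two points in one small ball, whereas \<open>p\<close> runs over
  all of \<open>M\<close>. Finitely many balls of half the radius cover \<open>K\<close>; a point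
  \<open>p\<close> close to \<open>x\<close> then shares the full ball with it, and for a distant
  \<open>p\<close> a large constant makes the claim trivial.\<close>

lemma compact_second_order:
  fixes M :: "'a::euclidean_space set"
  assumes M: "embedded_submanifold d M" and K: "compact K" "K \<subseteq> M"
  obtains C where "C \<ge> 0"
    "\<And>x p. x \<in> K \<Longrightarrow> p \<in> M \<Longrightarrow>
      \<exists>q\<in>tangent_space M x. norm (p - x - q) \<le> C * (norm (p - x))\<^sup>2"
    "\<And>x p w. x \<in> K \<Longrightarrow> p \<in> M \<Longrightarrow> w \<in> tangent_space M x \<Longrightarrow>
      \<exists>w'\<in>tangent_space M p. norm (w - w') \<le> C * norm (p - x) * norm w"
proof -
  define good where "good = (\<lambda>z r C. r > 0 \<and> C \<ge> 0 \<and>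
    (\<forall>x\<in>M \<inter> ball z r. \<forall>p\<in>M \<inter> ball z r.
      (\<exists>q\<in>tangent_space M x. norm (p - x - q) \<le> C * (norm (p - x))\<^sup>2) \<and>
      (\<forall>w\<in>tangent_space M x. \<exists>w'\<in>tangent_space M p. norm (w - w') \<le> C * norm (p - x) * norm w)))"
  have "\<exists>r C. good z r C" if "z \<in> K" for z
  proof -
    have zM: "z \<in> M" using that K by blast
    obtain U V S \<phi> \<psi> where "slice_chart M U V S \<phi> \<psi>" and z: "z \<in> U"
      using embedded_submanifold_chart[OF M zM] by blast
    then interpret slice_chart M U V S \<phi> \<psi> by simp
    show ?thesis
      using local_second_order[OF z] unfolding good_def by metis
  qed
  then obtain r C where good: "\<And>z. z \<in> K \<Longrightarrow> good z (r z) (C z)" by metis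
  then have pos: "\<And>z. z \<in> K \<Longrightarrow> r z > 0" "\<And>z. z \<in> K \<Longrightarrow> C z \<ge> 0" unfolding good_def by auto
  have "K \<subseteq> (\<Union>z\<in>K. ball z (r z / 2))" using pos by force
  then obtain D where D: "D \<subseteq> K" "finite D" "K \<subseteq> (\<Union>z\<in>D. ball z (r z / 2))"
    using compactE_image[OF K(1), of K "\<lambda>z. ball z (r z / 2)"] by auto
  \<comment> \<open>Dominates every local constant \<open>C z\<close>, and every
    \<open>2 / r z\<close>, so that \<open>B * norm (p - x)\<close> is at least 1 once
    \<open>p\<close> is half a radius away from \<open>x\<close>.\<close>
  define B where "B = (\<Sum>z\<in>D. C z + 2 / r z)"
  have Bz: "C z + 2 / r z \<le> B" if "z \<in> D" for z
    unfolding B_def using D pos that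
    by (intro member_le_sum) (auto simp: subset_iff less_imp_le)
  \<comment> \<open>Far apart points satisfy the estimates trivially, with q = 0 and w' = 0.\<close>
  have near: "(\<exists>z. x \<in> ball z (r z) \<and> p \<in> ball z (r z) \<and> z \<in> K \<and> C z \<le> B) \<or> 1 \<le> B * norm (p - x)"
    if x: "x \<in> K" for x p
  proof -
    obtain z where z: "z \<in> D" "dist z x < r z / 2" using D(3) x by auto
    have zK: "z \<in> K" using z(1) D(1) by blast
    have nn: "0 \<le> 2 / r z" "0 \<le> C z" using pos[OF zK] by auto
    show ?thesis
    proof (cases "norm (p - x) < r z / 2")
      case True
      then have "dist z p < r z"
        using z(2) dist_triangle[of z p x] by (simp add: dist_norm norm_minus_commute)
      moreover have "C z \<le> B" using Bz[OF z(1)] nn by linarith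
      ultimately show ?thesis
        using z zK pos[OF zK] by (intro disjI1 exI[of _ z]) auto
    next
      case False
      have Bz': "0 \<le> B" "2 / r z \<le> B" using Bz[OF z(1)] nn by linarith+
      have "1 = (2 / r z) * (r z / 2)" using pos[OF zK] by simp
      also have "\<dots> \<le> B * norm (p - x)"
        using False Bz' pos[OF zK] by (intro mult_mono) auto
      finally show ?thesis by blast
    qed
  qed
  show thesis
  proof (rule that[of B])
    show B0: "B \<ge> 0" unfolding B_def using D pos by (intro sum_nonneg) (auto simp: subset_iff less_imp_le)
    fix x p assume x: "x \<in> K" and p: "p \<in> M"
    show "\<exists>q\<in>tangent_space M x. norm (p - x - q) \<le> B * (norm (p - x))\<^sup>2"
      using near[OF x, of p]
    proof (elim disjE exE conjE)
      fix z assume z: "x \<in> ball z (r z)" "p \<in> ball z (r z)" "z \<in> K" "C z \<le> B"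
      then obtain q where "q \<in> tangent_space M x" "norm (p - x - q) \<le> C z * (norm (p - x))\<^sup>2"
        using good[OF z(3)] x p K unfolding good_def by blast
      then show ?thesis using z(4) by (meson mult_right_mono order_trans zero_le_power2)
    next
      assume *: "1 \<le> B * norm (p - x)"
      have "norm (p - x) \<le> B * (norm (p - x))\<^sup>2"
        using mult_right_mono[OF *, of "norm (p - x)"] by (simp add: power2_eq_square mult_ac)
      then show ?thesis
        using subspace_0[OF subspace_tangent_space[OF M]] x K by (intro bexI[of _ 0]) auto
    qed
  next
    fix x p w assume x: "x \<in> K" and p: "p \<in> M" and w: "w \<in> tangent_space M x"
    show "\<exists>w'\<in>tangent_space M p. norm (w - w') \<le> B * norm (p - x) * norm w"
      using near[OF x, of p]
    proof (elim disjE exE conjE)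
      fix z assume z: "x \<in> ball z (r z)" "p \<in> ball z (r z)" "z \<in> K" "C z \<le> B"
      then obtain w' where "w' \<in> tangent_space M p" "norm (w - w') \<le> C z * norm (p - x) * norm w"
        using good[OF z(3)] x p w K unfolding good_def by blast
      then show ?thesis using z(4) by (meson mult_right_mono order_trans norm_ge_zero)
    next
      assume *: "1 \<le> B * norm (p - x)"
      have "norm w \<le> B * norm (p - x) * norm w"
        using mult_right_mono[OF *, of "norm w"] by simp
      then show ?thesis
        using subspace_0[OF subspace_tangent_space[OF M p]] by (intro bexI[of _ 0]) auto
    qed
  qed
qed

section \<open>Orthogonality of nearest points and of linear projections\<close>

text \<open>Along a curve in \<open>M\<close> with velocity \<open>w\<close> at \<open>p\<close>,
  the squared distance to \<open>y\<close> is minimal at time 0, so its derivative, a multiple of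
  \<open>w \<bullet> (y - p)\<close>, vanishes there.\<close>

lemma nearest_point_normal:
  assumes "is_nearest_point M y p" and w: "w \<in> tangent_space M p"
  shows "w \<bullet> (y - p) = 0"
proof -
  obtain c e where c: "e > 0" "c ` {-e<..<e} \<subseteq> M" "c (0::real) = p"
    "(c has_vector_derivative w) (at 0)"
    using w unfolding tangent_space_def by blast
  have "((\<lambda>t. (y - c t) \<bullet> (y - c t)) has_derivative
      (\<lambda>t. (y - c 0) \<bullet> (0 - t *\<^sub>R w) + (0 - t *\<^sub>R w) \<bullet> (y - c 0))) (at 0)"
    using c(4)[unfolded has_vector_derivative_def]
    by (intro has_derivative_inner has_derivative_diff has_derivative_const)
  moreover have "\<forall>t\<in>{-e<..<e}. (y - c 0) \<bullet> (y - c 0) \<le> (y - c t) \<bullet> (y - c t)"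
  proof
    fix t assume "t \<in> {-e<..<e}"
    then have "c t \<in> M" using c by blast
    then have "norm (y - p) \<le> norm (y - c t)"
      using assms(1) unfolding is_nearest_point_def is_arg_min_linorder by (simp add: dist_norm)
    then show "(y - c 0) \<bullet> (y - c 0) \<le> (y - c t) \<bullet> (y - c t)"
      by (simp add: c(3) norm_le)
  qed
  ultimately have "(\<lambda>t::real. (y - c 0) \<bullet> (0 - t *\<^sub>R w) + (0 - t *\<^sub>R w) \<bullet> (y - c 0)) = (\<lambda>v. 0)"
    using c(1) by (intro differential_zero_maxmin[where S = "{-e<..<e}" and x = "0::real"]) auto
  from fun_cong[OF this, of 1] show ?thesis by (simp add: c(3) inner_commute)
qed

text \<open>Justifies the definite description. Existence is the orthogonal decomposition; the
  difference of two candidates lies in \<open>S\<close> and is orthogonal to itself.\<close>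

lemma orth_proj:
  assumes "subspace S"
  shows "orth_proj S y \<in> S" and "w \<in> S \<Longrightarrow> w \<bullet> (y - orth_proj S y) = 0"
proof -
  have "\<exists>!p. p \<in> S \<and> y - p \<in> orthogonal_comp S"
  proof -
    obtain a b where ab: "a \<in> span S" "\<And>w. w \<in> span S \<Longrightarrow> orthogonal b w" "y = a + b"
      using orthogonal_subspace_decomp_exists[of S y] by blast
    show ?thesis
    proof (rule ex1I[of _ a])
      show "a \<in> S \<and> y - a \<in> orthogonal_comp S"
        using ab assms by (auto simp: orthogonal_comp_def orthogonal_commute span_eq_iff[THEN iffD2])
      fix p assume p: "p \<in> S \<and> y - p \<in> orthogonal_comp S"
      then have "a - p \<in> S" using ab(1) assms by (auto simp: span_eq_iff[THEN iffD2] intro: subspace_diff)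
      then have "(a - p) \<bullet> (y - p) = 0" "(a - p) \<bullet> b = 0"
        using p ab(2)[of "a - p"] span_superset[of S] by (auto simp: orthogonal_comp_def orthogonal_def inner_commute)
      then have "(a - p) \<bullet> (a - p) = 0" unfolding ab(3) by (simp add: inner_diff_right inner_add_right)
      then show "p = a" by simp
    qed
  qed
  from theI'[OF this] have *: "orth_proj S y \<in> S \<and> y - orth_proj S y \<in> orthogonal_comp S"
    unfolding orth_proj_def .
  then show "orth_proj S y \<in> S" "w \<in> S \<Longrightarrow> w \<bullet> (y - orth_proj S y) = 0"
    by (auto simp: orthogonal_comp_def orthogonal_def)
qed

section \<open>Gradients and Bregman directions\<close>

text \<open>The definite description is met by the vector with coordinates \<open>D i\<close>, which
  represents the linear functional \<open>D\<close> by the inner product; representing vectors are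
  unique.\<close>

lemma nabla:
  fixes f :: "'a::euclidean_space \<Rightarrow> real"
  assumes "f differentiable (at x)"
  shows "(f has_derivative (\<lambda>w. w \<bullet> nabla f x)) (at x)"
    and "frechet_derivative f (at x) w = w \<bullet> nabla f x"
proof -
  define D where "D = frechet_derivative f (at x)"
  have D: "(f has_derivative D) (at x)"
    using assms frechet_derivative_works unfolding D_def by blast
  have lin: "linear D" using D has_derivative_linear by blast
  have "w \<bullet> (\<Sum>i\<in>Basis. D i *\<^sub>R i) = D w" for w
  proof -
    have "D w = D (\<Sum>i\<in>Basis. (w \<bullet> i) *\<^sub>R i)" by (simp add: euclidean_representation)
    also have "\<dots> = (\<Sum>i\<in>Basis. (w \<bullet> i) * D i)"
      by (simp only: linear_sum[OF lin] linear_scale[OF lin] real_scaleR_def)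
    finally show ?thesis by (simp add: inner_sum_right mult.commute)
  qed
  then have grad: "GDERIV f x :> (\<Sum>i\<in>Basis. D i *\<^sub>R i)"
    using D by (simp add: gderiv_def)
  have unique: "a = b" if "GDERIV f x :> a" "GDERIV f x :> b" for a b
  proof -
    have "\<forall>w. w \<bullet> a = w \<bullet> b"
      using fun_cong[OF has_derivative_unique[OF that[unfolded gderiv_def]]] by simp
    then show ?thesis by (rule vector_eq_ldot[THEN iffD1])
  qed
  have "GDERIV f x :> nabla f x"
    unfolding nabla_def
    by (rule theI[where P = "\<lambda>g. GDERIV f x :> g", OF grad unique[OF _ grad]])
  then show *: "(f has_derivative (\<lambda>w. w \<bullet> nabla f x)) (at x)" by (simp add: gderiv_def)
  show "frechet_derivative f (at x) w = w \<bullet> nabla f x"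
    using fun_cong[OF frechet_derivative_at[OF *], of w] by simp
qed

lemma continuous_nabla:
  fixes f :: "'a::euclidean_space \<Rightarrow> real"
  assumes "C_k_on 1 f UNIV"
  shows "continuous_on UNIV (nabla f)"
proof -
  have "(\<lambda>x. \<Sum>i\<in>Basis. frechet_derivative f (at x) i *\<^sub>R i) = nabla f"
    using assms by (simp add: nabla(2) inner_commute[of _ "nabla f _"] euclidean_representation)
  moreover have "continuous_on UNIV (\<lambda>x. \<Sum>i\<in>Basis. frechet_derivative f (at x) i *\<^sub>R i)"
    using assms by (intro continuous_intros) auto
  ultimately show ?thesis by (rule subst[where P = "continuous_on UNIV"])
qed

lemma C_2_on_imp_C_1_on:
  assumes "C_k_on 2 f S" "open S"
  shows "C_k_on 1 f S"
proof -
  have "continuous_on S (\<lambda>x. frechet_derivative f (at x) e)" for e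
    using assms by (intro continuous_at_imp_continuous_on)
      (auto simp: numeral_2_eq_2 intro: differentiable_imp_continuous_within)
  then show ?thesis using assms by (simp add: numeral_2_eq_2)
qed

section \<open>Bregman distances and the direction subproblem\<close>

text \<open>Divide the strong convexity inequality at \<open>x + s *\<^sub>R (y - x)\<close> by s
  and let s decrease to 0: the left side becomes the directional derivative and the factor
  \<open>1 - s\<close> disappears.\<close>

lemma bregman_lower_bound:
  fixes h :: "'a::euclidean_space \<Rightarrow> real"
  assumes "strongly_convex lam h" "h differentiable (at x)"
  shows "lam / 2 * (norm (y - x))\<^sup>2 \<le> bregman h y x"
proof -
  have "((\<lambda>s. h (x + s *\<^sub>R (y - x))) has_derivative (\<lambda>s. (s *\<^sub>R (y - x)) \<bullet> nabla h x)) (at 0)"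
    by (rule has_derivative_compose[where g = h])
      (use nabla(1)[OF assms(2)] in \<open>auto intro!: derivative_eq_intros\<close>)
  then have "((\<lambda>s. h (x + s *\<^sub>R (y - x))) has_vector_derivative (y - x) \<bullet> nabla h x) (at 0)"
    by (simp add: has_vector_derivative_def)
  from has_vector_derivative_quotient[OF this]
  have lim: "((\<lambda>s. (h (x + s *\<^sub>R (y - x)) - h x) / s) \<longlongrightarrow> (y - x) \<bullet> nabla h x) (at_right 0)"
    by (auto simp: divide_inverse mult.commute intro: tendsto_within_subset)
  have "((\<lambda>s. h y - h x - lam / 2 * (1 - s) * (norm (y - x))\<^sup>2)
      \<longlongrightarrow> h y - h x - lam / 2 * (1 - 0) * (norm (y - x))\<^sup>2) (at_right (0::real))"
    by (intro tendsto_intros)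
  moreover have "\<forall>\<^sub>F s in at_right 0. (h (x + s *\<^sub>R (y - x)) - h x) / s
      \<le> h y - h x - lam / 2 * (1 - s) * (norm (y - x))\<^sup>2"
  proof (rule eventually_at_rightI[of 0 1])
    fix s :: real assume s: "s \<in> {0<..<1}"
    have "h ((1 - s) *\<^sub>R x + s *\<^sub>R y)
          \<le> (1 - s) * h x + s * h y - lam / 2 * s * (1 - s) * (norm (x - y))\<^sup>2"
      using assms(1) s unfolding strongly_convex_def by auto
    moreover have "(1 - s) *\<^sub>R x + s *\<^sub>R y = x + s *\<^sub>R (y - x)" by (simp add: algebra_simps)
    ultimately have "h (x + s *\<^sub>R (y - x)) - h x
        \<le> s * (h y - h x - lam / 2 * (1 - s) * (norm (y - x))\<^sup>2)"
      by (simp add: algebra_simps norm_minus_commute)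
    then show "(h (x + s *\<^sub>R (y - x)) - h x) / s \<le> h y - h x - lam / 2 * (1 - s) * (norm (y - x))\<^sup>2"
      using s by (simp add: pos_divide_le_eq mult.commute)
  qed simp
  ultimately have "(y - x) \<bullet> nabla h x \<le> h y - h x - lam / 2 * (1 - 0) * (norm (y - x))\<^sup>2"
    by (rule tendsto_le[OF trivial_limit_at_right_real _ lim])
  then show ?thesis by (simp add: bregman_def inner_commute)
qed

text \<open>The objective vanishes at 0 and, by strong convexity, is nonnegative outside a ball. A
  minimizer over that compact ball is therefore global, so the choice made by \<open>arg_min\<close>
  is a genuine minimizer.\<close>

lemma bregman_direction_is_arg_min:
  fixes h :: "'a::euclidean_space \<Rightarrow> real"
  assumes h: "strongly_convex lam h" "\<And>x. h differentiable (at x)" and pos: "lam > 0" "\<gamma> > 0"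
  shows "is_arg_min (\<lambda>v. riem_grad M f x \<bullet> v + \<gamma> * bregman h (x + v) x) (\<lambda>_. True)
    (bregman_direction M f h \<gamma> x)"
proof -
  let ?g = "riem_grad M f x"
  define q where "q = (\<lambda>v. ?g \<bullet> v + \<gamma> * bregman h (x + v) x)"
  \<comment> \<open>The radius from which the quadratic lower bound \<gamma> lam |w|^2 / 2 outweighs
    the linear term, which is at least - |g| |w|.\<close>
  define R where "R = 2 * norm ?g / (\<gamma> * lam)"
  have R: "R \<ge> 0" unfolding R_def using pos by simp
  have "continuous_on UNIV h"
    using h(2) by (simp add: continuous_on_eq_continuous_at differentiable_imp_continuous_within)
  then have "continuous_on (cball 0 R) q"
    unfolding q_def bregman_def
    by (intro continuous_intros) (auto intro!: continuous_on_compose2[of UNIV h] continuous_intros)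
  then obtain v where v: "v \<in> cball 0 R" "\<And>w. w \<in> cball 0 R \<Longrightarrow> q v \<le> q w"
    using continuous_attains_inf[of "cball 0 R" q] R by auto
  have "q v \<le> q w" for w
  proof (cases "w \<in> cball 0 R")
    case False
    then have w: "norm w > R" by simp
    have "norm ?g * norm w \<le> \<gamma> * (lam / 2 * (norm w)\<^sup>2)"
    proof -
      have "norm ?g * norm w = \<gamma> * lam / 2 * (R * norm w)"
        using pos by (simp add: R_def)
      also have "\<dots> \<le> \<gamma> * lam / 2 * (norm w * norm w)"
        using w pos by (intro mult_left_mono mult_right_mono) auto
      finally show ?thesis by (simp add: power2_eq_square)
    qed
    moreover have "- (norm ?g * norm w) \<le> ?g \<bullet> w"
      using Cauchy_Schwarz_ineq2[of ?g w] by linarith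
    moreover have "\<gamma> * (lam / 2 * (norm w)\<^sup>2) \<le> \<gamma> * bregman h (x + w) x"
      using bregman_lower_bound[OF h, of "x + w" x] pos by (intro mult_left_mono) auto
    ultimately have "q w \<ge> 0" unfolding q_def by linarith
    moreover have "q v \<le> q 0" using v(2) R by simp
    moreover have "q 0 = 0" by (simp add: q_def bregman_def)
    ultimately show ?thesis by simp
  qed (use v in auto)
  then have "is_arg_min q (\<lambda>_. True) v" by (simp add: is_arg_min_linorder)
  then show ?thesis
    unfolding bregman_direction_def q_def[symmetric] arg_min_def by (rule someI)
qed

lemma bregman_direction_stationary:
  fixes M :: "'a::euclidean_space set" and f h :: "'a \<Rightarrow> real" and x :: 'a
  assumes h: "strongly_convex lam h" "\<And>x. h differentiable (at x)" and pos: "lam > 0" "\<gamma> > 0"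
  defines "v \<equiv> bregman_direction M f h \<gamma> x"
  shows "riem_grad M f x = \<gamma> *\<^sub>R (nabla h x - nabla h (x + v))"
proof -
  let ?g = "riem_grad M f x"
  have 1: "((\<lambda>v. h (x + v)) has_derivative (\<lambda>w. w \<bullet> nabla h (x + v))) (at v)"
    by (rule has_derivative_compose[where g = h])
      (use nabla(1)[OF h(2)] in \<open>auto intro!: derivative_eq_intros\<close>)
  have "((\<lambda>v. ?g \<bullet> v + \<gamma> * bregman h (x + v) x) has_derivative
      (\<lambda>w. ?g \<bullet> w + \<gamma> * (w \<bullet> nabla h (x + v) - nabla h x \<bullet> w))) (at v)"
    unfolding bregman_def by (auto intro!: derivative_eq_intros 1)
  moreover have "\<forall>w\<in>UNIV. ?g \<bullet> v + \<gamma> * bregman h (x + v) x \<le> ?g \<bullet> w + \<gamma> * bregman h (x + w) x"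
    using bregman_direction_is_arg_min[OF h pos] unfolding v_def is_arg_min_linorder by blast
  ultimately have "(\<lambda>w. ?g \<bullet> w + \<gamma> * (w \<bullet> nabla h (x + v) - nabla h x \<bullet> w)) = (\<lambda>w. 0)"
    by (intro differential_zero_maxmin[where S = UNIV and x = v]) auto
  then have "w \<bullet> (?g + \<gamma> *\<^sub>R (nabla h (x + v) - nabla h x)) = 0" for w
    by (auto simp: fun_eq_iff inner_add_right inner_diff_right inner_commute dest: spec[of _ w])
  then have "?g + \<gamma> *\<^sub>R (nabla h (x + v) - nabla h x) = 0"
    by (metis inner_eq_zero_iff)
  then show ?thesis by (simp add: algebra_simps eq_neg_iff_add_eq_0)
qed

text \<open>Adding the lower bounds for the two Bregman distances between \<open>x\<close> and
  \<open>x + v\<close> gives strong monotonicity of \<open>nabla h\<close>; the stationarity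
  equation paired with \<open>v\<close> turns it into descent.\<close>

lemma bregman_direction_descent:
  fixes M :: "'a::euclidean_space set" and f h :: "'a \<Rightarrow> real" and x :: 'a
  assumes h: "strongly_convex lam h" "\<And>x. h differentiable (at x)" and pos: "lam > 0" "\<gamma> > 0"
  defines "v \<equiv> bregman_direction M f h \<gamma> x"
  shows "riem_grad M f x \<bullet> v \<le> - (\<gamma> * lam * (norm v)\<^sup>2)"
proof -
  have "lam * (norm v)\<^sup>2 \<le> (nabla h (x + v) - nabla h x) \<bullet> v"
    using bregman_lower_bound[OF h, of x "x + v"] bregman_lower_bound[OF h, of "x + v" x]
    by (simp add: bregman_def inner_diff_left)
  then have "\<gamma> * (lam * (norm v)\<^sup>2) \<le> \<gamma> * ((nabla h (x + v) - nabla h x) \<bullet> v)"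
    using pos by simp
  moreover have "riem_grad M f x \<bullet> v = - (\<gamma> * ((nabla h (x + v) - nabla h x) \<bullet> v))"
    unfolding v_def by (subst bregman_direction_stationary[OF h pos]) (simp add: inner_diff_left algebra_simps)
  ultimately show ?thesis by simp
qed

section \<open>The Riemannian gradient and its limits\<close>

lemma riem_grad:
  assumes "embedded_submanifold d M" "x \<in> M"
  shows "riem_grad M f x \<in> tangent_space M x"
    and "w \<in> tangent_space M x \<Longrightarrow> w \<bullet> nabla f x = w \<bullet> riem_grad M f x"
    and "norm (riem_grad M f x) \<le> norm (nabla f x)"
proof -
  note T = orth_proj[OF subspace_tangent_space[OF assms], where y = "nabla f x", folded riem_grad_def]
  show 1: "riem_grad M f x \<in> tangent_space M x" by (rule T)
  show 2: "w \<bullet> nabla f x = w \<bullet> riem_grad M f x" if "w \<in> tangent_space M x" for w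
    using T(2)[OF that] by (simp add: inner_diff_right)
  have "norm (riem_grad M f x) * norm (riem_grad M f x) \<le> norm (riem_grad M f x) * norm (nabla f x)"
    using 2[OF 1] norm_cauchy_schwarz[of "riem_grad M f x" "nabla f x"]
    by (simp add: dot_square_norm power2_eq_square)
  then show "norm (riem_grad M f x) \<le> norm (nabla f x)"
    by (cases "riem_grad M f x = 0") auto
qed

lemma riem_grad_eq_0_limit:
  assumes M: "embedded_submanifold d M" and f: "C_k_on 1 f UNIV"
    and X: "\<And>n. X n \<in> M" "X \<longlonglongrightarrow> z" "z \<in> M"
    and g: "(\<lambda>n. riem_grad M f (X n)) \<longlonglongrightarrow> 0"
  shows "riem_grad M f z = 0"
proof -
  define w where "w = riem_grad M f z"
  have w: "w \<in> tangent_space M z" unfolding w_def by (rule riem_grad(1)[OF M X(3)])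
  \<comment> \<open>The uniform estimate is used with the one-point compact set containing
    \<open>z\<close>, and later with \<open>p = X n\<close>.\<close>
  obtain C where C: "\<And>p. p \<in> M \<Longrightarrow> \<exists>w'\<in>tangent_space M p. norm (w - w') \<le> C * norm (p - z) * norm w"
    using compact_second_order[OF M compact_insert[OF compact_empty], of z] X(3) w
    by (metis empty_subsetI insert_subset singletonI)
  obtain W where W: "\<And>n. W n \<in> tangent_space M (X n)" "\<And>n. norm (w - W n) \<le> C * norm (X n - z) * norm w"
    using C[OF X(1)] by metis
  have "(\<lambda>n. C * norm (X n - z) * norm w) \<longlonglongrightarrow> C * norm (z - z) * norm w"
    by (intro tendsto_intros X)
  then have "(\<lambda>n. C * norm (X n - z) * norm w) \<longlonglongrightarrow> 0" by simp
  then have "(\<lambda>n. w - W n) \<longlonglongrightarrow> 0"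
    by (rule Lim_null_comparison[OF always_eventually, rotated]) (use W(2) in blast)
  from tendsto_diff[OF tendsto_const[of w] this] have Ww: "W \<longlonglongrightarrow> w" by simp
  have "(\<lambda>n. W n \<bullet> nabla f (X n)) \<longlonglongrightarrow> w \<bullet> nabla f z"
    using continuous_nabla[OF f] X(2)
    by (intro tendsto_intros Ww) (auto simp: continuous_on_eq_continuous_at intro: isCont_tendsto_compose)
  moreover have "(\<lambda>n. W n \<bullet> nabla f (X n)) \<longlonglongrightarrow> w \<bullet> 0"
    unfolding riem_grad(2)[OF M X(1) W(1)] by (intro tendsto_intros Ww g)
  ultimately have "w \<bullet> nabla f z = 0" using LIMSEQ_unique by fastforce
  then have "w \<bullet> w = 0" using riem_grad(2)[OF M X(3) w] by (simp add: w_def)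
  then show ?thesis by (simp add: w_def)
qed

section \<open>Convergence of the algorithm\<close>

text \<open>The threshold \<open>A\<close> is fixed before \<open>x\<close>, \<open>v\<close> and
  \<open>u\<close>: this uniformity over \<open>K\<close> keeps accepted steps away from 0. Any
  nearest point \<open>p\<close> is allowed, so nothing depends on how the projection
  chooses.\<close>

lemma trial_point_decrease:
  fixes M :: "'a::euclidean_space set" and f h :: "'a \<Rightarrow> real"
  assumes M: "embedded_submanifold d M" and K: "compact K" "K \<subseteq> M"
    and f: "C_k_on 1 f UNIV" and h: "C_k_on 2 h UNIV" "strongly_convex lam h"
    and smooth: "rel_smooth L h f" and pos: "lam > 0" "L > 0" "\<tau> \<ge> 0"
  obtains A where "A > 0"
    "\<And>x v u \<alpha> p. x \<in> K \<Longrightarrow> v = bregman_direction M f h L x \<Longrightarrow> u \<in> normal_space M x \<Longrightarrow>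
      norm u \<le> \<tau> * norm v \<Longrightarrow> 0 \<le> \<alpha> \<Longrightarrow> \<alpha> \<le> 1 \<Longrightarrow> \<alpha> \<le> A \<Longrightarrow>
      is_nearest_point M (x + \<alpha> *\<^sub>R (v + u)) p \<Longrightarrow> f p - f x \<le> - (L * lam * \<alpha> / 4 * (norm v)\<^sup>2)"
proof -
  have hd: "h differentiable (at x)" for x
    using h(1) by (simp add: numeral_2_eq_2)
  obtain C where C: "C \<ge> 0"
    "\<And>x p. x \<in> K \<Longrightarrow> p \<in> M \<Longrightarrow>
      \<exists>q\<in>tangent_space M x. norm (p - x - q) \<le> C * (norm (p - x))\<^sup>2"
    "\<And>x p w. x \<in> K \<Longrightarrow> p \<in> M \<Longrightarrow> w \<in> tangent_space M x \<Longrightarrow>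
      \<exists>w'\<in>tangent_space M p. norm (w - w') \<le> C * norm (p - x) * norm w"
    using compact_second_order[OF M K] by metis
  have "compact (nabla f ` K)"
    using continuous_nabla[OF f] K(1) by (blast intro: compact_continuous_image continuous_on_subset)
  then obtain G where G: "G > 0" "\<And>x. x \<in> K \<Longrightarrow> norm (nabla f x) \<le> G"
    using compact_imp_bounded bounded_pos by (metis imageI)
  obtain b where b: "\<And>x. x \<in> K \<Longrightarrow> norm x \<le> b"
    using compact_imp_bounded[OF K(1)] by (auto simp: bounded_iff)
  \<comment> \<open>A ball around 0 that contains \<open>K\<close> and every relevant
    \<open>p\<close>: \<open>b\<close> bounds \<open>K\<close>, \<open>G / (L * lam)\<close> bounds
    \<open>norm v\<close>, and \<open>p\<close> is at most twice the trial displacement away from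
    \<open>x\<close>.\<close>
  define r where "r = b + 2 * ((1 + \<tau>) * (G / (L * lam)))"
  obtain C' where C': "C' \<ge> 0"
    "\<And>x y. x \<in> cball 0 r \<Longrightarrow> y \<in> cball 0 r \<Longrightarrow>
      norm (h y - h x - frechet_derivative h (at x) (y - x)) \<le> C' * (norm (y - x))\<^sup>2"
    using C_2_on_derivative_Lipschitz[OF h(1) subset_UNIV compact_cball convex_cball, of 0 r] by metis
  \<comment> \<open>Total coefficient of n^2 in the remainders: 8 C G from \<open>t1\<close>, 2 C G
    from \<open>t2\<close> and 4 L C' from \<open>t3\<close>. \<open>F\<close> results from it
    through n \<le> \<alpha> (1 + \<tau>) |v|.\<close>
  define E where "E = 10 * C * G + 4 * L * C'"
  define F where "F = E * (1 + \<tau>)\<^sup>2"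
  have E0: "E \<ge> 0" unfolding E_def using C(1) C'(1) G(1) pos by simp
  then have F0: "F \<ge> 0" unfolding F_def by simp
  show thesis
  \<comment> \<open>Accepting a step needs \<alpha> F \<le> 3/4 L lam, since a quarter of the
    decrease L lam must survive; \<open>F + 1\<close> avoids division by zero.\<close>
  proof (rule that[of "3 / 4 * (L * lam) / (F + 1)"])
    show "0 < 3 / 4 * (L * lam) / (F + 1)" using F0 pos by simp
    fix x v u \<alpha> p
    assume x: "x \<in> K" and v: "v = bregman_direction M f h L x" and u: "u \<in> normal_space M x"
      "norm u \<le> \<tau> * norm v" and \<alpha>: "0 \<le> \<alpha>" "\<alpha> \<le> 1" "\<alpha> \<le> 3 / 4 * (L * lam) / (F + 1)"
      and p: "is_nearest_point M (x + \<alpha> *\<^sub>R (v + u)) p"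
    define g where "g = riem_grad M f x"
    define w where "w = \<alpha> *\<^sub>R (v + u)"
    define n where "n = norm w"
    have xM: "x \<in> M" using x K by blast
    have pM: "p \<in> M" using p by (simp add: is_nearest_point_def is_arg_min_def)
    have gT: "g \<in> tangent_space M x" unfolding g_def by (rule riem_grad(1)[OF M xM])
    have gG: "norm g \<le> G" using riem_grad(3)[OF M xM, of f] G(2)[OF x] by (simp add: g_def)
    have gv: "g \<bullet> v \<le> - (L * lam * (norm v)\<^sup>2)"
      unfolding g_def v by (rule bregman_direction_descent[OF h(2) hd pos(1,2)])
    have gu: "g \<bullet> u = 0"
      using u(1) gT by (auto simp: normal_space_def orthogonal_comp_def orthogonal_def)
    \<comment> \<open>Descent and Cauchy-Schwarz give L lam |v|^2 \<le> |g| |v|; divide by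
      |v|.\<close>
    have nv: "norm v \<le> G / (L * lam)"
    proof (cases "v = 0")
      case False
      have "L * lam * (norm v)\<^sup>2 \<le> norm g * norm v"
        using gv Cauchy_Schwarz_ineq2[of g v] by linarith
      also have "\<dots> \<le> G * norm v" using gG by (simp add: mult_right_mono)
      finally have "L * lam * norm v \<le> G" using False by (simp add: power2_eq_square)
      then show ?thesis using pos by (simp add: pos_le_divide_eq mult.commute)
    qed (use G pos in simp)
    have n0: "n \<ge> 0" by (simp add: n_def)
    have nw: "n \<le> \<alpha> * ((1 + \<tau>) * norm v)"
    proof -
      have "norm (v + u) \<le> (1 + \<tau>) * norm v"
        using norm_triangle_ineq[of v u] u(2) by (simp add: distrib_right)
      then show ?thesis unfolding n_def w_def using \<alpha>(1) by (simp add: mult_left_mono)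
    qed
    \<comment> \<open>The point \<open>x\<close> itself competes with \<open>p\<close>, at distance
      n from the trial point.\<close>
    have yp: "norm (x + w - p) \<le> n"
      using p xM unfolding is_nearest_point_def is_arg_min_linorder w_def[symmetric] n_def
      by (auto simp: dist_norm dest!: spec[of _ x])
    have px: "norm (p - x) \<le> 2 * n"
      using norm_triangle_ineq4[of w "x + w - p"] yp by (simp add: n_def algebra_simps)
    have px2: "(norm (p - x))\<^sup>2 \<le> 4 * n\<^sup>2"
      using power_mono[OF px, of 2] by simp
    obtain q where q: "q \<in> tangent_space M x" "norm (p - x - q) \<le> C * (norm (p - x))\<^sup>2"
      using C(2)[OF x pM] by blast
    obtain g' where g': "g' \<in> tangent_space M p" "norm (g - g') \<le> C * norm (p - x) * norm g"
      using C(3)[OF x pM gT] by blast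
    have e1: "norm (p - x - q) \<le> 4 * C * n\<^sup>2"
      using q(2) mult_left_mono[OF px2 C(1)] by linarith
    \<comment> \<open>Since \<open>q\<close> is tangent at \<open>x\<close>,
      \<open>nabla f x\<close> may be replaced by \<open>g\<close> on it, at the cost of the second
      term. Then p - x = w - (x + w - p), and g' is orthogonal to x + w - p, so only g - g' remains
      on that part.\<close>
    have inner_split: "nabla f x \<bullet> (p - x) =
        \<alpha> * (g \<bullet> v) + (nabla f x - g) \<bullet> (p - x - q) - (g - g') \<bullet> (x + w - p)"
    proof -
      have "nabla f x \<bullet> q = g \<bullet> q" using riem_grad(2)[OF M xM q(1), of f] by (simp add: g_def inner_commute)
      moreover have "g' \<bullet> (x + w - p) = 0"
        using nearest_point_normal[OF p g'(1)] by (simp add: w_def)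
      moreover have "g \<bullet> w = \<alpha> * (g \<bullet> v)" by (simp add: w_def inner_add_right gu)
      ultimately show ?thesis by (simp add: inner_diff_left inner_diff_right inner_add_right)
    qed
    have t1: "(nabla f x - g) \<bullet> (p - x - q) \<le> 2 * G * (4 * C * n\<^sup>2)"
    proof -
      have "norm (nabla f x - g) \<le> 2 * G"
        using norm_triangle_ineq4[of "nabla f x" g] gG G(2)[OF x] by linarith
      then have "norm (nabla f x - g) * norm (p - x - q) \<le> 2 * G * (4 * C * n\<^sup>2)"
        using e1 G(1) by (intro mult_mono) auto
      then show ?thesis using norm_cauchy_schwarz order_trans by blast
    qed
    have t2: "- ((g - g') \<bullet> (x + w - p)) \<le> C * (2 * n) * G * n"
    proof -
      have "norm (g - g') \<le> C * (2 * n) * G"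
        by (rule order_trans[OF g'(2)]) (use C(1) px gG n0 in \<open>intro mult_mono; simp\<close>)
      then have "norm (g - g') * norm (x + w - p) \<le> C * (2 * n) * G * n"
        using yp C(1) G(1) n0 by (intro mult_mono) auto
      then show ?thesis using Cauchy_Schwarz_ineq2[of "g - g'" "x + w - p"] by linarith
    qed
    \<comment> \<open>The Bregman distance is the first-order Taylor remainder of \<open>h\<close>,
      so the C2 bound applies once both points are known to lie in the ball of radius
      \<open>r\<close>.\<close>
    have t3: "bregman h p x \<le> C' * (4 * n\<^sup>2)"
    proof -
      have "n \<le> (1 + \<tau>) * (G / (L * lam))"
      proof -
        have "n \<le> (1 + \<tau>) * norm v"
          by (rule order_trans[OF nw mult_left_le_one_le]) (use \<alpha> pos(3) in auto)
        also have "\<dots> \<le> (1 + \<tau>) * (G / (L * lam))" using nv pos(3) by (intro mult_left_mono) auto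
        finally show ?thesis .
      qed
      moreover have "norm p \<le> norm x + norm (p - x)" using norm_triangle_ineq[of x "p - x"] by simp
      ultimately have "x \<in> cball 0 r" "p \<in> cball 0 r"
        using b[OF x] px n0 unfolding r_def by auto
      from C'(2)[OF this] have "bregman h p x \<le> C' * (norm (p - x))\<^sup>2"
        by (simp add: bregman_def nabla(2)[OF hd] inner_commute)
      also have "\<dots> \<le> C' * (4 * n\<^sup>2)" using px2 C'(1) by (rule mult_left_mono)
      finally show ?thesis .
    qed
    have "f p - f x \<le> nabla f x \<bullet> (p - x) + L * bregman h p x"
      using smooth unfolding rel_smooth_def by (simp add: algebra_simps)
    also have "\<dots> \<le> \<alpha> * (g \<bullet> v) + 2 * G * (4 * C * n\<^sup>2) + C * (2 * n) * G * n + L * (C' * (4 * n\<^sup>2))"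
      using t1 t2 mult_left_mono[OF t3, of L] pos unfolding inner_split by linarith
    also have "\<dots> = \<alpha> * (g \<bullet> v) + E * n\<^sup>2"
      by (simp add: E_def algebra_simps power2_eq_square)
    also have "\<dots> \<le> \<alpha> * - (L * lam * (norm v)\<^sup>2) + E * (\<alpha> * ((1 + \<tau>) * norm v))\<^sup>2"
      using gv \<alpha>(1) E0 nw n0 by (intro add_mono mult_left_mono power_mono) auto
    also have "\<dots> = \<alpha> * (norm v)\<^sup>2 * (\<alpha> * F - L * lam)"
      by (simp add: F_def algebra_simps power2_eq_square)
    also have "\<dots> \<le> \<alpha> * (norm v)\<^sup>2 * (- (L * lam / 4))"
    proof (intro mult_left_mono)
      have "\<alpha> * (F + 1) \<le> 3 / 4 * (L * lam)" 
        using \<alpha>(3) F0 pos_le_divide_eq[of "F + 1" \<alpha> "3 / 4 * (L * lam)"] by linarith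
      then show "\<alpha> * F - L * lam \<le> - (L * lam / 4)" using \<alpha>(1) by (simp add: algebra_simps)
    qed (use \<alpha>(1) in simp)
    finally show "f p - f x \<le> - (L * lam * \<alpha> / 4 * (norm v)\<^sup>2)" by (simp add: algebra_simps)
  qed
qed

section \<open>The line search, telescoping, and the conclusion\<close>

text \<open>An accepted exponent \<open>j\<close> witnesses termination, so unfolding the loop
  \<open>j\<close> times determines its value, which would otherwise be unspecified.\<close>

lemma while_backtracking:
  fixes R :: "real \<Rightarrow> bool"
  assumes "\<And>i. i < j \<Longrightarrow> R (\<rho> ^ i)" "\<not> R (\<rho> ^ j)"
  shows "while R (\<lambda>a. \<rho> * a) 1 = \<rho> ^ j"
proof -
  have "n \<le> j \<Longrightarrow> while R (\<lambda>a. \<rho> * a) 1 = while R (\<lambda>a. \<rho> * a) (\<rho> ^ n)" for n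
  proof (induction n)
    case (Suc n)
    then show ?case
      using assms(1)[of n] while_unfold[of R "\<lambda>a. \<rho> * a" "\<rho> ^ n"] by simp
  qed simp
  from this[of j] show ?thesis
    using assms(2) while_unfold[of R "\<lambda>a. \<rho> * a" "\<rho> ^ j"] by simp
qed

lemma sufficient_decrease_rate:
  fixes a w :: "nat \<Rightarrow> real"
  assumes c: "c > 0" and dec: "\<And>t. a (Suc t) \<le> a t - c * (w t)\<^sup>2" and lb: "\<And>t. m \<le> a t"
    and w: "\<And>t. w t \<ge> 0"
  shows "w \<longlonglongrightarrow> 0"
    and "\<exists>C>0. \<forall>\<epsilon>>0. \<exists>t::nat. real t \<le> C / \<epsilon>\<^sup>2 \<and> w t \<le> \<epsilon>"
proof -
  \<comment> \<open>The added 1 makes \<open>B\<close> positive and a strict bound for all partial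
    sums.\<close>
  define B where "B = (a 0 - m) / c + 1"
  have "c * (\<Sum>t<T. (w t)\<^sup>2) \<le> a 0 - a T" for T
  proof (induction T)
    case (Suc T)
    then show ?case using dec[of T] by (simp add: algebra_simps)
  qed simp
  then have "c * (\<Sum>t<T. (w t)\<^sup>2) \<le> a 0 - m" for T
    using lb[of T] by (meson diff_left_mono order_trans)
  then have "(\<Sum>t<T. (w t)\<^sup>2) \<le> (a 0 - m) / c" for T
    using c by (simp add: pos_le_divide_eq mult.commute)
  then have sum: "(\<Sum>t<T. (w t)\<^sup>2) < B" for T
    unfolding B_def by (smt (verit))
  have "summable (\<lambda>t. (w t)\<^sup>2)"
    by (rule summableI_nonneg_bounded[of _ B]) (use sum in \<open>auto simp: less_imp_le\<close>)
  then have "(\<lambda>t. (w t)\<^sup>2) \<longlonglongrightarrow> 0" by (rule summable_LIMSEQ_zero)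
  then show "w \<longlonglongrightarrow> 0" by simp
  have "B > 0" using sum[of 0] by simp
  moreover have "\<exists>t::nat. real t \<le> B / \<epsilon>\<^sup>2 \<and> w t \<le> \<epsilon>" if \<epsilon>: "\<epsilon> > 0" for \<epsilon>
  proof (rule ccontr)
    assume neg: "\<not> ?thesis"
    \<comment> \<open>The indices below \<open>T\<close> are those with t \<le> B / \<epsilon>^2. If
      all of them had w t > \<epsilon>, their squares would sum to at least T \<epsilon>^2 >
      B.\<close>
    define T where "T = Suc (nat \<lfloor>B / \<epsilon>\<^sup>2\<rfloor>)"
    have "\<epsilon>\<^sup>2 \<le> (w t)\<^sup>2" if "t < T" for t
    proof -
      have "real t \<le> B / \<epsilon>\<^sup>2"
        using that \<open>B > 0\<close> \<epsilon> unfolding T_def by (simp add: less_Suc_eq_le le_nat_floor le_floor_iff nat_le_iff le_nat_iff)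
      then have "\<epsilon> < w t" using neg by (meson not_le_imp_less)
      then show ?thesis using \<epsilon> by (intro power_mono) auto
    qed
    then have "real T * \<epsilon>\<^sup>2 \<le> (\<Sum>t<T. (w t)\<^sup>2)"
      using sum_bounded_below[of "{..<T}" "\<epsilon>\<^sup>2" "\<lambda>t. (w t)\<^sup>2"] by simp
    moreover have "B / \<epsilon>\<^sup>2 < real T" unfolding T_def by linarith
    then have "B < real T * \<epsilon>\<^sup>2" using \<epsilon> by (simp add: pos_divide_less_eq)
    ultimately show False using sum[of T] by simp
  qed
  ultimately show "\<exists>C>0. \<forall>\<epsilon>>0. \<exists>t::nat. real t \<le> C / \<epsilon>\<^sup>2 \<and> w t \<le> \<epsilon>" by blast
qed

theorem theorem4p1:
  fixes M :: "(real ^ 'n) set" and d :: nat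
    and f h :: "real ^ 'n \<Rightarrow> real"
    and L lam \<tau> \<rho> :: real
    and P :: "real ^ 'n \<Rightarrow> real ^ 'n"
    and xtilde :: "real ^ 'n"
    and x v u :: "nat \<Rightarrow> real ^ 'n" and \<alpha> :: "nat \<Rightarrow> real"
  assumes manifold: "embedded_submanifold d M" and complete: "riem_complete M"
    and f_C1: "C_k_on 1 f UNIV" and f_bdd: "bdd_below (f ` M)"
    and h_C2: "C_k_on 2 h UNIV" and lam_pos: "lam > 0" and h_convex: "strongly_convex lam h"
    and L_pos: "L > 0" and f_smooth: "rel_smooth L h f"
    and xtilde: "xtilde \<in> M" and sublevel: "compact {y \<in> M. f y \<le> f xtilde}"
    and tau: "\<tau> \<ge> 0" and rho: "0 < \<rho>" "\<rho> < 1"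
    and run: "rbg_run M f h lam (\<lambda>_. L) \<tau> \<rho> P xtilde x v u \<alpha>"
  shows "(\<forall>z. (\<exists>r::nat \<Rightarrow> nat. strict_mono r \<and> (x \<circ> r) \<longlonglongrightarrow> z) \<longrightarrow> z \<in> M \<and> riem_grad M f z = 0) \<and>
         (\<exists>C::real. C > 0 \<and> (\<forall>\<epsilon>>0. \<exists>t::nat. real t \<le> C / \<epsilon>\<^sup>2 \<and> norm (v t) \<le> \<epsilon>))"
proof -
  \<comment> \<open>The initial sublevel set: monotone decrease keeps all iterates in it, and its
    compactness makes the constants uniform.\<close>
  define K where "K = {y \<in> M. f y \<le> f xtilde}"
  have K: "compact K" "K \<subseteq> M" using sublevel by (auto simp: K_def)
  have hd: "h differentiable (at x)" for x
    using h_C2 by (simp add: numeral_2_eq_2)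
  obtain A where A: "A > 0"
    "\<And>x v u \<alpha> p. x \<in> K \<Longrightarrow> v = bregman_direction M f h L x \<Longrightarrow> u \<in> normal_space M x \<Longrightarrow>
      norm u \<le> \<tau> * norm v \<Longrightarrow> 0 \<le> \<alpha> \<Longrightarrow> \<alpha> \<le> 1 \<Longrightarrow> \<alpha> \<le> A \<Longrightarrow>
      is_nearest_point M (x + \<alpha> *\<^sub>R (v + u)) p \<Longrightarrow> f p - f x \<le> - (L * lam * \<alpha> / 4 * (norm v)\<^sup>2)"
    using trial_point_decrease[OF manifold K f_C1 h_C2 h_convex f_smooth lam_pos L_pos tau] by metis
  \<comment> \<open>Lower bound for accepted steps: either the first trial 1 is accepted, or the
    preceding trial was rejected, hence exceeded \<open>A\<close>, and was then multiplied by
    \<rho>.\<close>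
  define a where "a = min 1 (\<rho> * A)"
  define c where "c = L * lam * a / 4"
  have a0: "a > 0" using A(1) rho by (simp add: a_def)
  then have c0: "c > 0" using L_pos lam_pos by (simp add: c_def)
  have x0: "x 0 = xtilde" and v: "\<And>t. v t = bregman_direction M f h L (x t)"
    and u: "\<And>t. u t \<in> normal_space M (x t)" "\<And>t. norm (u t) \<le> \<tau> * norm (v t)"
    and \<alpha>: "\<And>t. \<alpha> t = while (rejected f P L lam (x t) (v t) (u t)) (\<lambda>a. \<rho> * a) 1"
    and x_Suc: "\<And>t. x (Suc t) = P (x t + \<alpha> t *\<^sub>R (v t + u t))"
    and near: "\<And>t j. (\<And>i. i < j \<Longrightarrow> rejected f P L lam (x t) (v t) (u t) (\<rho> ^ i)) \<Longrightarrow>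
      is_nearest_point M (x t + (\<rho> ^ j) *\<^sub>R (v t + u t)) (P (x t + (\<rho> ^ j) *\<^sub>R (v t + u t)))"
    using run unfolding rbg_run_def Let_def by blast+
  have step: "x (Suc t) \<in> M \<and> f (x (Suc t)) \<le> f (x t) - c * (norm (v t))\<^sup>2" if xK: "x t \<in> K" for t
  proof -
    define R where "R = rejected f P L lam (x t) (v t) (u t)"
    \<comment> \<open>Nearest points are guaranteed only at trial points actually reached, hence the
      premise that all earlier trials were rejected.\<close>
    have accept: "\<not> R (\<rho> ^ j)" if "\<And>i. i < j \<Longrightarrow> R (\<rho> ^ i)" "\<rho> ^ j \<le> A" for j
      using A(2)[OF xK v u _ _ that(2) near[OF that(1)[unfolded R_def]]] rho
      by (simp add: R_def rejected_def power_le_one)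
    \<comment> \<open>If every trial were rejected, all would be reached, and some power of \<rho>
      below \<open>A\<close> would contradict \<open>accept\<close>. The least accepted exponent is
      where the loop stops.\<close>
    have "\<exists>j. \<not> R (\<rho> ^ j)"
      using accept real_arch_pow_inv[OF A(1) rho(2)] by (metis less_imp_le)
    then obtain j where j: "\<not> R (\<rho> ^ j)" "\<And>i. i < j \<Longrightarrow> R (\<rho> ^ i)"
      unfolding exists_least_iff[of "\<lambda>j. \<not> R (\<rho> ^ j)"] by blast
    then have \<alpha>j: "\<alpha> t = \<rho> ^ j" unfolding \<alpha> R_def[symmetric] by (rule while_backtracking[rotated])
    have "a \<le> \<alpha> t"
    proof (cases j)
      case (Suc i)
      have "A < \<rho> ^ i" using accept[of i] j(2) Suc by (meson less_Suc_eq not_le_imp_less)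
      then show ?thesis using rho(1) by (simp add: a_def \<alpha>j Suc min.coboundedI2)
    qed (simp add: \<alpha>j a_def)
    have "x (Suc t) \<in> M"
      using near[OF j(2)[unfolded R_def]] by (simp add: x_Suc \<alpha>j is_nearest_point_def is_arg_min_def)
    moreover have "f (x (Suc t)) \<le> f (x t) - L * lam * \<alpha> t / 4 * (norm (v t))\<^sup>2"
      using j(1) by (simp add: R_def rejected_def x_Suc \<alpha>j)
    moreover have "c * (norm (v t))\<^sup>2 \<le> L * lam * \<alpha> t / 4 * (norm (v t))\<^sup>2"
      unfolding c_def using \<open>a \<le> \<alpha> t\<close> L_pos lam_pos by (intro mult_right_mono) auto
    ultimately show ?thesis by linarith
  qed
  have xK: "x t \<in> K" for t
  proof (induction t)
    case 0
    then show ?case using x0 xtilde by (simp add: K_def)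
  next
    case (Suc t)
    have "0 \<le> c * (norm (v t))\<^sup>2" using c0 by simp
    then show ?case using step[OF Suc] Suc unfolding K_def by auto
  qed
  obtain m where m: "\<And>y. y \<in> M \<Longrightarrow> m \<le> f y"
    using f_bdd by (auto simp: bdd_below_def)
  have "f (x (Suc t)) \<le> f (x t) - c * (norm (v t))\<^sup>2" "m \<le> f (x t)" for t
    using step[OF xK] m xK K(2) by blast+
  note rate = sufficient_decrease_rate[where a = "\<lambda>t. f (x t)" and w = "\<lambda>t. norm (v t)", OF c0 this norm_ge_zero]
  have "z \<in> M \<and> riem_grad M f z = 0" if r: "strict_mono r" "(x \<circ> r) \<longlonglongrightarrow> z" for z r
  proof -
    \<comment> \<open>The compact set \<open>K\<close> is closed in the ambient space, so limits of
      iterates stay in \<open>K\<close> and thus in \<open>M\<close>.\<close>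
    have z: "z \<in> M"
      using closed_sequentially[OF compact_imp_closed[OF K(1)], of "x \<circ> r" z] xK r(2) K(2) by auto
    have "(\<lambda>n. v (r n)) \<longlonglongrightarrow> 0"
      using LIMSEQ_subseq_LIMSEQ[OF tendsto_norm_zero_cancel[OF rate(1)] r(1)] by (simp add: o_def)
    \<comment> \<open>Both arguments of \<open>nabla h\<close> in the stationarity equation now
      converge to \<open>z\<close>, so their difference of gradients vanishes in the limit.\<close>
    then have xv: "(\<lambda>n. (x \<circ> r) n + v (r n)) \<longlonglongrightarrow> z + 0"
      by (intro tendsto_intros r(2))
    have cont: "isCont (nabla h) z"
      using continuous_nabla[OF C_2_on_imp_C_1_on[OF h_C2]] by (simp add: continuous_on_eq_continuous_at)
    have "(\<lambda>n. L *\<^sub>R (nabla h ((x \<circ> r) n) - nabla h ((x \<circ> r) n + v (r n))))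
        \<longlonglongrightarrow> L *\<^sub>R (nabla h z - nabla h z)"
      using xv by (intro tendsto_intros isCont_tendsto_compose[OF cont] r(2)) simp
    then have "(\<lambda>n. riem_grad M f ((x \<circ> r) n)) \<longlonglongrightarrow> 0"
      using bregman_direction_stationary[OF h_convex hd lam_pos L_pos] by (simp add: v)
    then show ?thesis
      using riem_grad_eq_0_limit[OF manifold f_C1 _ r(2) z] xK K(2) z by (auto simp: subset_iff)
  qed
  then show ?thesis using rate(2) by blast
qed

end
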